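(* Let $\Phi_M,\Phi_N:\mathcal{L}(\mathcal{H}_A)\to\mathcal{L}(\mathcal{H}_B)$ be two measurement channels corresponding to the $n$-outcome POVMs $M=\{M_i\}_{i=0}^{n-1}$ and $N=\{N_i\}_{i=0}^{n-1}$. The channels $\Phi_M,\Phi_N$ form a Maximal Entanglement Worst Case pair if and only if there exist a pure state $|\phi\rangle\langle\phi|\in\mathcal{L}(\mathcal{H}_A)$ and coefficients $\gamma_i\in\mathbb{C}$ such that $M_i-N_i=\gamma_i|\phi\rangle\langle\phi|$ for all $i\in\{0,\ldots,n-1\}$. Moreover, the optimal input state is then necessarily $\rho_{AA'}=|\phi\rangle\langle\phi|\otimes\tau$, where $\tau\in\mathcal{D}(\mathcal{H}_{A'})$ is an arbitrary state.
   Context: The measurement channel of a POVM $M$ is $\Phi_M(\rho)=\sum_{i=0}^{n-1}\operatorname{Tr}(\rho M_i)\,|i\rangle\langle i|$. For channel discrimination with uniform priors using an input $\rho_{AA'}$, with $d=\dim\mathcal{H}_A$, $\Delta_\Phi=\Phi_M-\Phi_N$, diamond norm $\|\mathcal{S}\|_\diamond=\max_{\rho_{AA'}}\|(\mathcal{S}\otimes I_{A'})\rho_{AA'}\|_1$ and ME-norm $\|\mathcal{S}\|_{\mathrm{ME}}=\|J(\mathcal{S})/d\|_1$ with Choi operator $J(\mathcal{S})=\sum_{ij}\mathcal{S}(|i\rangle\langle j|)\otimes|i\rangle\langle j|$, a pair is Maximal Entanglement Worst Case (MEWC) if $\|\Delta_\Phi\|_\diamond=d\|\Delta_\Phi\|_{\mathrm{ME}}$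 (the maximal possible gap; a maximally entangled input is maximally suboptimal).
   Formalization: The claim about optimal input states is stated only when M and N differ (some M_i ≠ N_i); if M = N, every input state is optimal and the claim fails. The equivalence itself has no such restriction. *)

theory Defs
  imports "Jordan_Normal_Form.Schur_Decomposition" "Jordan_Normal_Form.Char_Poly"
begin

definition mtrace :: "complex mat \<Rightarrow> complex" where
  "mtrace A = (\<Sum>i<dim_row A. A $$ (i, i))"

definition psd :: "nat \<Rightarrow> complex mat \<Rightarrow> bool" where
  "psd n A \<longleftrightarrow> A \<in> carrier_mat n n \<and>
     (\<forall>v \<in> carrier_vec n. let q = conjugate v \<bullet> (A *\<^sub>v v) in Im q = 0 \<and> Re q \<ge> 0)"

definition density :: "nat \<Rightarrow> complex mat \<Rightarrow> bool" where
  "density n \<rho> \<longleftrightarrow> psd n \<rho> \<and> mtrace \<rho> = 1"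

definition povm :: "nat \<Rightarrow> nat \<Rightarrow> (nat \<Rightarrow> complex mat) \<Rightarrow> bool" where
  "povm d n M \<longleftrightarrow> (\<forall>i<n. psd d (M i)) \<and>
     (\<forall>a<d. \<forall>b<d. (\<Sum>i<n. M i $$ (a, b)) = (1\<^sub>m d :: complex mat) $$ (a, b))"

definition meas_channel :: "nat \<Rightarrow> (nat \<Rightarrow> complex mat) \<Rightarrow> complex mat \<Rightarrow> complex mat" where
  "meas_channel n M \<rho> = mat n n (\<lambda>(i, j). if i = j then mtrace (\<rho> * M i) else 0)"

definition ket_bra :: "nat \<Rightarrow> nat \<Rightarrow> nat \<Rightarrow> complex mat" where
  "ket_bra d i j = mat d d (\<lambda>(a, b). if a = i \<and> b = j then 1 else 0)"

text \<open>Kronecker (tensor) product; index (a,b) of the composite is a * dim(B) + b.\<close>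
definition kron :: "complex mat \<Rightarrow> complex mat \<Rightarrow> complex mat" where
  "kron A B = mat (dim_row A * dim_row B) (dim_col A * dim_col B)
     (\<lambda>(i, j). A $$ (i div dim_row B, j div dim_col B) * B $$ (i mod dim_row B, j mod dim_col B))"

text \<open>Block (i,j) of size k x k of a (d*k) x (d*k) matrix, i.e. (<i| (x) I) X (|j> (x) I).\<close>
definition block :: "nat \<Rightarrow> complex mat \<Rightarrow> nat \<Rightarrow> nat \<Rightarrow> complex mat" where
  "block k X i j = mat k k (\<lambda>(a, b). X $$ (i * k + a, j * k + b))"

text \<open>(S (x) I_{A'}) applied to rho_{AA'} with dim A = d, dim A' = k, for a (linear) map S
  on d x d matrices: sum_{ij} S(|i><j|) (x) rho_{ij}.\<close>
definition tensor_id_apply :: "nat \<Rightarrow> nat \<Rightarrow> (complex mat \<Rightarrow> complex mat) \<Rightarrow> complex mat \<Rightarrow> complex mat" where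
  "tensor_id_apply d k S \<rho> =
     (let r = dim_row (S (0\<^sub>m d d)) in
      mat (r * k) (r * k) (\<lambda>pq. \<Sum>i<d. \<Sum>j<d. kron (S (ket_bra d i j)) (block k \<rho> i j) $$ pq))"

text \<open>Trace norm: the sum of singular values, i.e. of the square roots of the eigenvalues
  (with multiplicity) of X^* X.\<close>
definition trace_norm :: "complex mat \<Rightarrow> real" where
  "trace_norm X = sum_mset (image_mset (\<lambda>z. sqrt (Re z)) (proots (char_poly (mat_adjoint X * X))))"

text \<open>Diamond norm of a map on d x d matrices: max over rho_{AA'} with dim A' = dim A = d.\<close>
definition diamond_norm :: "nat \<Rightarrow> (complex mat \<Rightarrow> complex mat) \<Rightarrow> real" where
  "diamond_norm d S = (SUP \<rho> \<in> {\<rho>. density (d * d) \<rho>}. trace_norm (tensor_id_apply d d S \<rho>))"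

definition choi :: "nat \<Rightarrow> (complex mat \<Rightarrow> complex mat) \<Rightarrow> complex mat" where
  "choi d S = (let r = dim_row (S (0\<^sub>m d d)) in
     mat (r * d) (r * d) (\<lambda>pq. \<Sum>i<d. \<Sum>j<d. kron (S (ket_bra d i j)) (ket_bra d i j) $$ pq))"

definition me_norm :: "nat \<Rightarrow> (complex mat \<Rightarrow> complex mat) \<Rightarrow> real" where
  "me_norm d S = trace_norm ((1 / of_nat d) \<cdot>\<^sub>m choi d S)"

definition MEWC :: "nat \<Rightarrow> (complex mat \<Rightarrow> complex mat) \<Rightarrow> (complex mat \<Rightarrow> complex mat) \<Rightarrow> bool" where
  "MEWC d \<Phi> \<Psi> \<longleftrightarrow>
     (let \<Delta> = (\<lambda>\<rho>. \<Phi> \<rho> - \<Psi> \<rho>) in diamond_norm d \<Delta> = of_nat d * me_norm d \<Delta>)"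

definition unit_vector :: "nat \<Rightarrow> complex vec \<Rightarrow> bool" where
  "unit_vector d \<phi> \<longleftrightarrow> \<phi> \<in> carrier_vec d \<and> (\<Sum>i<d. cmod (\<phi> $ i) ^ 2) = 1"

definition proj :: "complex vec \<Rightarrow> complex mat" where
  "proj \<phi> = mat (dim_vec \<phi>) (dim_vec \<phi>) (\<lambda>(i, j). \<phi> $ i * cnj (\<phi> $ j))"

end

theory Submission
  imports Defs "HOL-Computational_Algebra.Fundamental_Theorem_Algebra"
begin

text \<open>
  Write \<open>D\<^sub>i = M\<^sub>i - N\<^sub>i\<close>. The output on \<open>\<rho>\<close> is block diagonal with Hermitian blocks
  \<open>Tr\<^sub>A ((D\<^sub>i \<otimes> I) \<rho>)\<close>, and the Choi operator has the blocks \<open>D\<^sub>i\<^sup>T\<close>, so \<open>d\<close> times the ME-norm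
  is \<open>\<Sum>\<^sub>i \<parallel>D\<^sub>i\<parallel>\<^sub>1\<close>. Splitting each \<open>D\<^sub>i\<close> into eigenprojections bounds the value of \<open>\<rho>\<close> by
  \<open>Tr (P \<rho>\<^sub>A)\<close> with \<open>P = \<Sum>\<^sub>i |D\<^sub>i|\<close>, hence by the largest eigenvalue of \<open>P\<close>, whereas
  \<open>\<Sum>\<^sub>i \<parallel>D\<^sub>i\<parallel>\<^sub>1 = Tr P\<close>. For an MEWC pair the largest eigenvalue of \<open>P\<close> is therefore at least its
  trace, so \<open>P\<close>, and with it every \<open>D\<^sub>i\<close>, is supported on one line; no compactness of the set of
  states is needed. Conversely, if \<open>D\<^sub>i = \<gamma>\<^sub>i |\<phi>\<rangle>\<langle>\<phi>|\<close>, the value of \<open>\<rho>\<close> is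
  \<open>\<Sum>\<^sub>i |\<gamma>\<^sub>i|\<close> times \<open>\<langle>\<phi>|\<rho>\<^sub>A|\<phi>\<rangle>\<close>, and this factor is \<open>1\<close> exactly for \<open>\<rho> = |\<phi>\<rangle>\<langle>\<phi>| \<otimes> \<tau>\<close>.
  Operators are handled as functions of two indices.
\<close>

section \<open>Spectral decomposition and trace norm\<close>

definition onb :: "nat \<Rightarrow> (nat \<Rightarrow> nat \<Rightarrow> complex) \<Rightarrow> bool" where
  "onb m u \<longleftrightarrow> (\<forall>j<m. \<forall>l<m. (\<Sum>a<m. cnj (u j a) * u l a) = (if j = l then 1 else 0))"

lemma onbD:
  "onb m u \<Longrightarrow> j < m \<Longrightarrow> l < m \<Longrightarrow> (\<Sum>a<m. cnj (u j a) * u l a) = (if j = l then 1 else 0)"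
  by (auto simp: onb_def)

text \<open>With the vectors as columns of \<open>P\<close>, orthonormality says that the adjoint
  \<open>Q\<close> is a left inverse of \<open>P\<close>. For square matrices it is then also a
  right inverse, which is the completeness relation.\<close>

lemma onb_complete:
  assumes "onb m u" "a < m" "b < m"
  shows "(\<Sum>j<m. u j a * cnj (u j b)) = (if a = b then 1 else 0)"
proof -
  define P where "P = mat m m (\<lambda>(a, j). u j a)"
  define Q where "Q = mat m m (\<lambda>(j, a). cnj (u j a))"
  have P: "P \<in> carrier_mat m m" and Q: "Q \<in> carrier_mat m m"
    by (auto simp: P_def Q_def)
  have "Q * P = 1\<^sub>m m"
    using assms(1) by (intro eq_matI) (auto simp: P_def Q_def scalar_prod_def onb_def atLeast0LessThan)
  hence "P * Q = 1\<^sub>m m"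
    using mat_mult_left_right_inverse[OF Q P] by simp
  hence "(P * Q) $$ (a, b) = (if a = b then 1 else 0)"
    using assms by simp
  thus ?thesis
    using assms by (simp add: P_def Q_def scalar_prod_def atLeast0LessThan)
qed

text \<open>Complete \<open>v\<close> to a basis that starts with \<open>v\<close>; Gram-Schmidt
  keeps this first vector, and normalising leaves \<open>u 0\<close> a multiple of
  \<open>v\<close>.\<close>

lemma onb_extends:
  fixes v :: "complex vec"
  assumes v: "v \<in> carrier_vec m" and v0: "v \<noteq> 0\<^sub>v m"
  shows "\<exists>u c. onb m u \<and> (\<forall>a<m. u 0 a = c * v $ a)"
proof -
  interpret cof_vec_space m "TYPE(complex)" .
  define b where "b = basis_completion v"
  define ws where "ws = gram_schmidt m b"
  from basis_completion[OF v v0, folded b_def]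
  have dist_b: "distinct b" and indep: "\<not> lin_dep (set b)"
    and b: "set b \<subseteq> carrier_vec m" and hdb: "hd b = v" and len_b: "length b = m"
    by auto
  have m: "m > 0"
    using v v0 by (cases m) auto
  from hdb len_b m obtain vs where bv: "b = v # vs"
    by (cases b) auto
  from gram_schmidt_result[OF b dist_b indep refl, folded ws_def]
  have ws: "set ws \<subseteq> carrier_vec m" "corthogonal ws" "length ws = m"
    by (auto simp: len_b)
  have hdws: "hd ws = v"
    using gram_schmidt_hd[OF v, of vs, folded bv] unfolding ws_def .
  have dim: "dim_vec (ws ! j) = m" if "j < m" for j
    using ws that by (metis carrier_vecD nth_mem subsetD)
  define N where "N j = (\<Sum>a<m. (cmod (ws ! j $ a))\<^sup>2)" for j
  have ip: "(\<Sum>a<m. cnj (ws ! j $ a) * ws ! l $ a) = (if j = l then of_real (N j) else 0)"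
    if "j < m" "l < m" for j l
  proof (cases "j = l")
    case True
    thus ?thesis
      unfolding N_def of_real_sum complex_norm_square by (simp only: mult.commute simp_thms if_True)
  next
    case False
    have "ws ! l \<bullet>c ws ! j = 0"
      using corthogonalD[OF ws(2), of l j] ws(3) that False by simp
    thus ?thesis
      using False dim that by (simp add: scalar_prod_def atLeast0LessThan mult.commute)
  qed
  have N: "N j > 0" if "j < m" for j
  proof -
    have "ws ! j \<bullet>c ws ! j \<noteq> 0"
      using corthogonalD[OF ws(2), of j j] ws(3) that by simp
    hence "(\<Sum>a<m. cnj (ws ! j $ a) * ws ! j $ a) \<noteq> 0"
      using dim that by (simp add: scalar_prod_def atLeast0LessThan mult.commute)
    hence "N j \<noteq> 0" using ip[OF that that] by auto
    moreover have "N j \<ge> 0" unfolding N_def by (intro sum_nonneg) auto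
    ultimately show ?thesis by simp
  qed
  \<comment> \<open>\<open>corthogonal\<close> yields pairwise orthogonal nonzero vectors of
    arbitrary length, so each one is divided by its norm.\<close>
  define u where "u j a = of_real (1 / sqrt (N j)) * ws ! j $ a" for j a
  have "onb m u" unfolding onb_def
  proof (intro allI impI)
    fix j l assume jl: "j < m" "l < m"
    have "(\<Sum>a<m. cnj (u j a) * u l a) =
        of_real (1 / sqrt (N j)) * of_real (1 / sqrt (N l)) * (\<Sum>a<m. cnj (ws ! j $ a) * ws ! l $ a)"
      unfolding u_def by (simp add: sum_distrib_left mult_ac)
    also have "\<dots> = (if j = l then 1 else 0)"
      using ip[OF jl] N[OF jl(1)] by (auto simp flip: of_real_mult)
    finally show "(\<Sum>a<m. cnj (u j a) * u l a) = (if j = l then 1 else 0)" .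
  qed
  moreover have "ws ! 0 = v"
    using hdws ws(3) m by (cases ws) auto
  ultimately show ?thesis
    by (intro exI[of _ u] exI[of _ "of_real (1 / sqrt (N 0))"]) (simp add: u_def)
qed

section \<open>Spectral theorem for Hermitian operators\<close>

definition hermitian :: "nat \<Rightarrow> (nat \<Rightarrow> nat \<Rightarrow> complex) \<Rightarrow> bool" where
  "hermitian m A \<longleftrightarrow> (\<forall>a<m. \<forall>b<m. A a b = cnj (A b a))"

text \<open>The eigenvalues are complex so that the notion also covers normal operators, such as a
  complex multiple of a Hermitian one.\<close>

definition eigdec ::
  "nat \<Rightarrow> (nat \<Rightarrow> nat \<Rightarrow> complex) \<Rightarrow> (nat \<Rightarrow> nat \<Rightarrow> complex) \<Rightarrow> (nat \<Rightarrow> complex) \<Rightarrow> bool" where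
  "eigdec m A u l \<longleftrightarrow> onb m u \<and>
     (\<forall>a<m. \<forall>b<m. A a b = (\<Sum>j<m. l j * (u j a * cnj (u j b))))"

lemma eigdecD:
  assumes "eigdec m A u l"
  shows "onb m u" "a < m \<Longrightarrow> b < m \<Longrightarrow> A a b = (\<Sum>j<m. l j * (u j a * cnj (u j b)))"
  using assms by (auto simp: eigdec_def)

lemma exists_eigenvector:
  fixes A :: "complex mat"
  assumes A: "A \<in> carrier_mat m m" and m: "m > 0"
  shows "\<exists>v e. v \<in> carrier_vec m \<and> v \<noteq> 0\<^sub>v m \<and> A *\<^sub>v v = e \<cdot>\<^sub>v v"
proof -
  have "degree (char_poly A) = m"
    using degree_monic_char_poly[OF A] by simp
  hence "\<not> constant (poly (char_poly A))"
    using m by (simp add: constant_degree)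
  then obtain e where "poly (char_poly A) e = 0"
    using fundamental_theorem_of_algebra by blast
  hence "eigenvalue A e"
    using eigenvalue_root_char_poly[OF A] by simp
  thus ?thesis
    using A unfolding eigenvalue_def eigenvector_def by auto
qed

lemma sum_delta_mult:
  fixes f :: "nat \<Rightarrow> 'a::semiring_1"
  assumes "a < m"
  shows "(\<Sum>j<m. (if a = j then 1 else 0) * f j) = f a" "(\<Sum>j<m. (if j = a then 1 else 0) * f j) = f a"
    "(\<Sum>j<m. f j * (if a = j then 1 else 0)) = f a" "(\<Sum>j<m. f j * (if j = a then 1 else 0)) = f a"
  using assms by (auto simp: if_distrib[of "\<lambda>x. x * _"] if_distrib[of "\<lambda>x. _ * x"] cong: if_cong)

lemma onb_expand:
  assumes "onb m w" "a < m"
  shows "(\<Sum>i<m. w i a * (\<Sum>c<m. cnj (w i c) * f c)) = f a"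
proof -
  have "(\<Sum>i<m. w i a * (\<Sum>c<m. cnj (w i c) * f c)) = (\<Sum>c<m. (\<Sum>i<m. w i a * cnj (w i c)) * f c)"
    unfolding sum_distrib_left sum_distrib_right by (subst sum.swap) (simp add: mult_ac)
  also have "\<dots> = (\<Sum>c<m. (if a = c then 1 else 0) * f c)"
    using onb_complete[OF assms(1,2)] by (intro sum.cong) auto
  finally show ?thesis using sum_delta_mult[OF assms(2)] by metis
qed

lemma onb_expand_right:
  assumes "onb m w" "b < m"
  shows "(\<Sum>j<m. (\<Sum>e<m. f e * w j e) * cnj (w j b)) = f b"
proof -
  have "cnj (\<Sum>j<m. (\<Sum>e<m. f e * w j e) * cnj (w j b)) =
    (\<Sum>j<m. w j b * (\<Sum>e<m. cnj (w j e) * cnj (f e)))"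
    by (simp add: mult_ac)
  also have "\<dots> = cnj (f b)" by (rule onb_expand[OF assms])
  finally show ?thesis by (simp only: complex_cnj_cancel_iff)
qed

text \<open>The coefficients are the matrix entries of \<open>A\<close> in the basis
  \<open>w\<close>; completeness of \<open>w\<close> is used once for each index.\<close>

lemma onb_expand_kernel:
  assumes w: "onb m w" and ab: "a < m" "b < m"
  shows "A a b = (\<Sum>i<m. \<Sum>j<m. (\<Sum>c<m. \<Sum>e<m. cnj (w i c) * A c e * w j e) * (w i a * cnj (w j b)))"
proof -
  have "(\<Sum>i<m. \<Sum>j<m. (\<Sum>c<m. \<Sum>e<m. cnj (w i c) * A c e * w j e) * (w i a * cnj (w j b)))
    = (\<Sum>i<m. w i a * (\<Sum>j<m. \<Sum>c<m. cnj (w i c) * ((\<Sum>e<m. A c e * w j e) * cnj (w j b))))"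
    by (simp add: sum_distrib_left sum_distrib_right mult_ac)
  also have "\<dots> = (\<Sum>i<m. w i a * (\<Sum>c<m. cnj (w i c) * (\<Sum>j<m. (\<Sum>e<m. A c e * w j e) * cnj (w j b))))"
    by (subst sum.swap) (simp add: sum_distrib_left)
  also have "\<dots> = (\<Sum>i<m. w i a * (\<Sum>c<m. cnj (w i c) * A c b))"
    by (simp only: onb_expand_right[OF w ab(2)])
  also have "\<dots> = A a b" by (rule onb_expand[OF w ab(1)])
  finally show ?thesis by simp
qed

text \<open>Induction on the dimension. In an orthonormal basis whose first vector is an
  eigenvector, hermiticity clears the first row and column outside the corner, and the remaining
  block is diagonalised by the induction hypothesis.\<close>

theorem spectral_theorem:
  "hermitian m A \<Longrightarrow> \<exists>u l. eigdec m A u (\<lambda>j. of_real (l j))"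
proof (induction m arbitrary: A)
  case 0
  thus ?case by (simp add: eigdec_def onb_def)
next
  case (Suc m)
  define B where "B = mat (Suc m) (Suc m) (\<lambda>(a, b). A a b)"
  obtain v e where v: "v \<in> carrier_vec (Suc m)" "v \<noteq> 0\<^sub>v (Suc m)" "B *\<^sub>v v = e \<cdot>\<^sub>v v"
    using exists_eigenvector[of B "Suc m"] by (auto simp: B_def)
  obtain w c where w: "onb (Suc m) w" and wv: "\<And>a. a < Suc m \<Longrightarrow> w 0 a = c * v $ a"
    using onb_extends[OF v(1,2)] by auto
  have Av: "(\<Sum>b<Suc m. A a b * v $ b) = e * v $ a" if "a < Suc m" for a
  proof -
    have "(B *\<^sub>v v) $ a = (e \<cdot>\<^sub>v v) $ a" by (simp add: v)
    thus ?thesis using that v(1)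
      by (simp add: B_def scalar_prod_def atLeast0LessThan del: sum.lessThan_Suc)
  qed
  have Aw: "(\<Sum>b<Suc m. A a b * w 0 b) = e * w 0 a" if "a < Suc m" for a
  proof -
    have "(\<Sum>b<Suc m. A a b * w 0 b) = c * (\<Sum>b<Suc m. A a b * v $ b)"
      unfolding sum_distrib_left using wv by (intro sum.cong) auto
    thus ?thesis using Av[OF that] wv[OF that] by simp
  qed
  \<comment> \<open>\<open>K\<close> is the matrix of \<open>A\<close> in the basis
    \<open>w\<close>.\<close>
  define K where "K i j = (\<Sum>c<Suc m. \<Sum>e<Suc m. cnj (w i c) * A c e * w j e)" for i j
  have Aherm: "cnj (A a b) = A b a" if "a < Suc m" "b < Suc m" for a b
    using Suc.prems that unfolding hermitian_def by metis
  have Kherm: "K i j = cnj (K j i)" for i j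
  proof -
    have "cnj (K j i) = (\<Sum>c<Suc m. \<Sum>e<Suc m. w j c * A e c * cnj (w i e))"
      unfolding K_def cnj_sum complex_cnj_mult using Aherm by (intro sum.cong) auto
    also have "\<dots> = K i j"
      unfolding K_def by (subst sum.swap) (simp only: mult_ac)
    finally show ?thesis by simp
  qed
  have K0: "K i 0 = (if i = 0 then e else 0)" if "i < Suc m" for i
  proof -
    have "K i 0 = (\<Sum>c<Suc m. cnj (w i c) * (\<Sum>e<Suc m. A c e * w 0 e))"
      unfolding K_def by (simp only: sum_distrib_left mult_ac)
    also have "\<dots> = (\<Sum>c<Suc m. cnj (w i c) * (e * w 0 c))"
      by (intro sum.cong refl) (simp only: Aw lessThan_iff)
    also have "\<dots> = e * (\<Sum>c<Suc m. cnj (w i c) * w 0 c)"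
      by (simp only: sum_distrib_left mult_ac)
    also have "\<dots> = (if i = 0 then e else 0)" using onbD[OF w that, of 0] by simp
    finally show ?thesis .
  qed
  \<comment> \<open>\<open>e\<close> is the corner of \<open>K\<close>, and diagonal entries of a
    Hermitian matrix are real.\<close>
  have e: "e = of_real (Re e)"
  proof -
    have "e = cnj e" using Kherm[of 0 0] K0[of 0] by simp
    thus ?thesis by (metis Reals_cnj_iff of_real_Re)
  qed
  have K0': "K 0 (Suc j) = 0" if "j < m" for j
    using Kherm[of 0 "Suc j"] K0[of "Suc j"] that by simp
  have "hermitian m (\<lambda>i j. K (Suc i) (Suc j))"
    unfolding hermitian_def using Kherm by blast
  from Suc.IH[OF this] obtain x l
    where xl: "eigdec m (\<lambda>i j. K (Suc i) (Suc j)) x (\<lambda>j. of_real (l j))"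
    by blast
  have xK: "K (Suc i) (Suc j) = (\<Sum>k<m. of_real (l k) * (x k i * cnj (x k j)))"
    if "i < m" "j < m" for i j
    using eigdecD(2)[OF xl that] .
  \<comment> \<open>The eigenvectors \<open>x k\<close> of the lower block are coordinate vectors
    with respect to \<open>w 1\<close>, ..., \<open>w m\<close>; they are mapped back to the
    original space.\<close>
  define u where "u k a = (case k of 0 \<Rightarrow> w 0 a | Suc k \<Rightarrow> (\<Sum>i<m. x k i * w (Suc i) a))" for k a
  have u0: "u 0 a = w 0 a" and uS: "u (Suc k) a = (\<Sum>i<m. x k i * w (Suc i) a)" for k a
    by (auto simp: u_def)
  have ipw: "(\<Sum>a<Suc m. cnj (w i a) * u (Suc k) a) = (case i of 0 \<Rightarrow> 0 | Suc i \<Rightarrow> x k i)"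
    if "i < Suc m" for i k
  proof -
    have "(\<Sum>a<Suc m. cnj (w i a) * u (Suc k) a) = (\<Sum>j<m. x k j * (\<Sum>a<Suc m. cnj (w i a) * w (Suc j) a))"
      unfolding uS sum_distrib_left by (subst sum.swap) (simp only: mult_ac)
    also have "\<dots> = (\<Sum>j<m. x k j * (if i = Suc j then 1 else 0))"
      using onbD[OF w that] by (intro sum.cong) auto
    also have "\<dots> = (case i of 0 \<Rightarrow> 0 | Suc i \<Rightarrow> x k i)"
      using that by (cases i) (auto simp: sum_delta_mult)
    finally show ?thesis .
  qed
  have onbu: "onb (Suc m) u" unfolding onb_def
  proof (intro allI impI)
    fix j k assume jk: "j < Suc m" "k < Suc m"
    show "(\<Sum>a<Suc m. cnj (u j a) * u k a) = (if j = k then 1 else 0)"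
    proof (cases j)
      case 0
      show ?thesis
      proof (cases k)
        case 0
        thus ?thesis using \<open>j = 0\<close> onbD[OF w jk] by (simp only: u0)
      next
        case (Suc k')
        thus ?thesis using \<open>j = 0\<close> ipw[of 0 k'] by (simp only: u0) simp
      qed
    next
      case (Suc j')
      show ?thesis
      proof (cases k)
        case 0
        have "(\<Sum>a<Suc m. cnj (u j a) * u k a) = cnj (\<Sum>a<Suc m. cnj (w 0 a) * u (Suc j') a)"
          unfolding 0 Suc u0 by (simp only: cnj_sum complex_cnj_mult complex_cnj_cnj mult_ac)
        also have "\<dots> = 0"
          by (subst ipw) auto
        finally show ?thesis
          unfolding 0 Suc by simp
      next
        case (Suc k')
        have "(\<Sum>a<Suc m. cnj (u j a) * u k a) =
          (\<Sum>i<m. cnj (x j' i) * (\<Sum>a<Suc m. cnj (w (Suc i) a) * u (Suc k') a))"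
          unfolding Suc \<open>j = Suc j'\<close> uS[of j'] cnj_sum sum_distrib_left sum_distrib_right
          by (subst sum.swap) (simp only: complex_cnj_mult mult_ac)
        also have "\<dots> = (\<Sum>i<m. cnj (x j' i) * x k' i)"
          using ipw by (intro sum.cong) auto
        also have "\<dots> = (if j = k then 1 else 0)"
          using onbD[OF eigdecD(1)[OF xl], of j' k'] jk Suc \<open>j = Suc j'\<close> by simp
        finally show ?thesis .
      qed
    qed
  qed
  define l' where "l' k = (case k of 0 \<Rightarrow> Re e | Suc k \<Rightarrow> l k)" for k
  have l0: "complex_of_real (l' 0) = e" and lS: "l' (Suc k) = l k" for k
    using e by (auto simp: l'_def)
  have "A a b = (\<Sum>j<Suc m. of_real (l' j) * (u j a * cnj (u j b)))" if "a < Suc m" "b < Suc m" for a b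
  proof -
    have "A a b = (\<Sum>i<Suc m. \<Sum>j<Suc m. K i j * (w i a * cnj (w j b)))"
      unfolding K_def by (rule onb_expand_kernel[OF w that])
    \<comment> \<open>By \<open>K0\<close> and \<open>K0'\<close> only the corner and the lower
      block of \<open>K\<close> contribute.\<close>
    also have "\<dots> = e * (w 0 a * cnj (w 0 b)) +
        (\<Sum>i<m. \<Sum>j<m. K (Suc i) (Suc j) * (w (Suc i) a * cnj (w (Suc j) b)))"
      unfolding sum.lessThan_Suc_shift using K0 K0' by simp
    also have "(\<Sum>i<m. \<Sum>j<m. K (Suc i) (Suc j) * (w (Suc i) a * cnj (w (Suc j) b))) =
      (\<Sum>i<m. \<Sum>j<m. \<Sum>k<m. of_real (l k) * ((x k i * w (Suc i) a) * cnj (x k j * w (Suc j) b)))"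
      using xK by (intro sum.cong) (auto simp: sum_distrib_left sum_distrib_right mult_ac)
    also have "\<dots> = (\<Sum>i<m. \<Sum>k<m. \<Sum>j<m. of_real (l k) * ((x k i * w (Suc i) a) * cnj (x k j * w (Suc j) b)))"
      by (intro sum.cong refl sum.swap)
    also have "\<dots> = (\<Sum>k<m. \<Sum>i<m. \<Sum>j<m. of_real (l k) * ((x k i * w (Suc i) a) * cnj (x k j * w (Suc j) b)))"
      by (rule sum.swap)
    also have "\<dots> = (\<Sum>k<m. of_real (l' (Suc k)) * (u (Suc k) a * cnj (u (Suc k) b)))"
      unfolding uS lS cnj_sum sum_product by (simp only: sum_distrib_left)
    finally show ?thesis
      unfolding sum.lessThan_Suc_shift l0 u0 .
  qed
  thus ?case
    using onbu unfolding eigdec_def by blast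
qed

section \<open>Trace norm from an eigendecomposition\<close>

lemma mat_adjoint_index:
  fixes X :: "complex mat"
  assumes "i < dim_col X" "j < dim_row X"
  shows "mat_adjoint X $$ (i, j) = cnj (X $$ (j, i))"
  using assms by (simp add: mat_adjoint_def mat_of_rows_index)

lemma mat_adjoint_carrier:
  fixes X :: "complex mat"
  shows "X \<in> carrier_mat m n \<Longrightarrow> mat_adjoint X \<in> carrier_mat n m"
  by (auto simp: mat_adjoint_def)

text \<open>The eigenbasis of \<open>X\<close> also diagonalises \<open>mat_adjoint X * X\<close>,
  with the squared moduli of the \<open>l j\<close> as eigenvalues; their square roots are the
  singular values.\<close>

lemma trace_norm_eigdec:
  assumes X: "X \<in> carrier_mat m m" and dec: "eigdec m (\<lambda>a b. X $$ (a, b)) u l"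
  shows "trace_norm X = (\<Sum>j<m. cmod (l j))"
proof -
  note u = eigdecD(1)[OF dec]
  define P where "P = mat m m (\<lambda>(a, j). u j a)"
  define Q where "Q = mat m m (\<lambda>(j, a). cnj (u j a))"
  define E where "E = mat m m (\<lambda>(i, j). if i = j then l i else 0)"
  define E' where "E' = mat m m (\<lambda>(i, j). if i = j then cnj (l i) else 0)"
  define D where "D = mat m m (\<lambda>(i, j). if i = j then of_real ((cmod (l i))\<^sup>2) else (0::complex))"
  have car: "P \<in> carrier_mat m m" "Q \<in> carrier_mat m m" "E \<in> carrier_mat m m"
      "E' \<in> carrier_mat m m" "D \<in> carrier_mat m m"
    by (auto simp: P_def Q_def E_def E'_def D_def)
  have QP: "Q * P = 1\<^sub>m m"
    using u by (intro eq_matI) (auto simp: P_def Q_def scalar_prod_def onb_def atLeast0LessThan)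
  have PQ: "P * Q = 1\<^sub>m m"
    using mat_mult_left_right_inverse[OF car(2,1) QP] .
  have diag: "mat m m (\<lambda>(i, j). if i = j then f i else 0) * R = mat m m (\<lambda>(i, j). f i * R $$ (i, j))"
    if "R \<in> carrier_mat m m" for f :: "nat \<Rightarrow> complex" and R
    using that by (intro eq_matI) (auto simp: scalar_prod_def atLeast0LessThan
        if_distrib[of "\<lambda>x. x * _"] cong: if_cong)
  have PEQ: "X = P * (E * Q)"
    unfolding E_def diag[OF car(2)]
    using X eigdecD(2)[OF dec] by (intro eq_matI) (auto simp: P_def Q_def scalar_prod_def atLeast0LessThan mult_ac)
  have adj: "mat_adjoint X = P * (E' * Q)"
    unfolding E'_def diag[OF car(2)]
    using X mat_adjoint_carrier[OF X] eigdecD(2)[OF dec]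
    by (intro eq_matI) (auto simp: mat_adjoint_index P_def Q_def scalar_prod_def atLeast0LessThan mult_ac)
  have norm_sq: "cnj z * z = of_real ((cmod z)\<^sup>2)" for z
    by (metis complex_norm_square mult.commute)
  have EE: "E' * E = D"
    unfolding E'_def diag[OF car(3)] unfolding D_def E_def
    by (intro eq_matI) (auto simp: norm_sq)
  have "mat_adjoint X * X = (P * (E' * Q)) * (P * (E * Q))"
    using PEQ adj by simp
  \<comment> \<open>The inner factor \<open>Q * P\<close> is the identity, so the two diagonal
    factors meet and multiply to \<open>D\<close>.\<close>
  also have "\<dots> = P * (E' * (Q * P) * E) * Q"
    using car by (simp add: assoc_mult_mat[of _ m m _ m _ m])
  also have "\<dots> = P * D * Q"
    using car by (simp add: QP EE)
  finally have "similar_mat_wit (mat_adjoint X * X) D P Q"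
    using car PQ QP X by (intro similar_mat_witI[of _ _ m]) (auto simp: mat_adjoint_def)
  hence "char_poly (mat_adjoint X * X) = char_poly D"
    by (intro char_poly_similar) (auto simp: similar_mat_def)
  \<comment> \<open>The characteristic polynomial of the diagonal matrix \<open>D\<close> is a
    product of linear factors, so its roots can be read off with multiplicity.\<close>
  also have "\<dots> = (\<Prod>a\<leftarrow>diag_mat D. [:- a, 1:])"
    by (rule char_poly_upper_triangular[OF car(5)]) (auto simp: D_def)
  also have "diag_mat D = map (\<lambda>i. of_real ((cmod (l i))\<^sup>2)) [0..<m]"
    by (auto simp: diag_mat_def D_def)
  finally have cp: "char_poly (mat_adjoint X * X) =
    (\<Prod>p\<leftarrow>map (\<lambda>i. [:- of_real ((cmod (l i))\<^sup>2), 1:]) [0..<m]. p)"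
    by (simp add: comp_def)
  have "proots (char_poly (mat_adjoint X * X)) =
    (\<Sum>i\<leftarrow>[0..<m]. {# complex_of_real ((cmod (l i))\<^sup>2) #})"
    unfolding cp by (subst proots_prod_list) (auto simp: comp_def)
  also have "\<dots> = mset (map (\<lambda>i. complex_of_real ((cmod (l i))\<^sup>2)) [0..<m])"
    by (induction m) auto
  finally show ?thesis
    unfolding trace_norm_def
    by (simp add: image_mset.compositionality comp_def sum_mset_sum_list flip: mset_map)
      (simp add: interv_sum_list_conv_sum_set_nat atLeast0LessThan)
qed

section \<open>Quadratic forms\<close>

definition qform :: "nat \<Rightarrow> (nat \<Rightarrow> nat \<Rightarrow> complex) \<Rightarrow> (nat \<Rightarrow> complex) \<Rightarrow> complex" where
  "qform m A v = (\<Sum>a<m. \<Sum>b<m. cnj (v a) * A a b * v b)"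

text \<open>Test vectors are arbitrary functions; only their first \<open>m\<close> values enter, so
  no carrier set has to be tracked.\<close>

definition pos_semidef :: "nat \<Rightarrow> (nat \<Rightarrow> nat \<Rightarrow> complex) \<Rightarrow> bool" where
  "pos_semidef m A \<longleftrightarrow> (\<forall>v. Im (qform m A v) = 0 \<and> Re (qform m A v) \<ge> 0)"

lemma qform_cong:
  "(\<And>a b. a < m \<Longrightarrow> b < m \<Longrightarrow> A a b = B a b) \<Longrightarrow> (\<And>a. a < m \<Longrightarrow> v a = w a) \<Longrightarrow> qform m A v = qform m B w"
  unfolding qform_def by (intro sum.cong) auto

lemma pos_semidef_cong:
  "(\<And>a b. a < m \<Longrightarrow> b < m \<Longrightarrow> A a b = B a b) \<Longrightarrow> pos_semidef m A \<longleftrightarrow> pos_semidef m B"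
  unfolding pos_semidef_def using qform_cong[of m A B] by metis

lemma psd_iff_pos_semidef:
  "psd m X \<longleftrightarrow> X \<in> carrier_mat m m \<and> pos_semidef m (\<lambda>a b. X $$ (a, b))"
proof -
  have q: "conjugate v \<bullet> (X *\<^sub>v v) = qform m (\<lambda>a b. X $$ (a, b)) (\<lambda>a. v $ a)"
    if "v \<in> carrier_vec m" "X \<in> carrier_mat m m" for v
    using that by (simp add: qform_def scalar_prod_def atLeast0LessThan sum_distrib_left mult_ac)
  have v: "qform m A v = qform m A (\<lambda>a. vec m v $ a)" for A v
    by (intro qform_cong) auto
  have "(\<forall>v \<in> carrier_vec m. Im (conjugate v \<bullet> (X *\<^sub>v v)) = 0 \<and> Re (conjugate v \<bullet> (X *\<^sub>v v)) \<ge> 0) \<longleftrightarrow>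
      pos_semidef m (\<lambda>a b. X $$ (a, b))" if "X \<in> carrier_mat m m"
    unfolding pos_semidef_def
  proof (intro iffI allI ballI)
    fix v :: "nat \<Rightarrow> complex"
    assume "\<forall>v\<in>carrier_vec m. Im (conjugate v \<bullet> (X *\<^sub>v v)) = 0 \<and> 0 \<le> Re (conjugate v \<bullet> (X *\<^sub>v v))"
    hence "Im (conjugate (vec m v) \<bullet> (X *\<^sub>v vec m v)) = 0 \<and> 0 \<le> Re (conjugate (vec m v) \<bullet> (X *\<^sub>v vec m v))"
      by auto
    thus "Im (qform m (\<lambda>a b. X $$ (a, b)) v) = 0 \<and> 0 \<le> Re (qform m (\<lambda>a b. X $$ (a, b)) v)"
      using q[OF vec_carrier that, of v] v[of _ v] by metis
  qed (use q that in auto)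
  thus ?thesis
    unfolding psd_def Let_def by blast
qed

lemma qform_basis2:
  assumes "a < m" "b < m" "a \<noteq> b"
  shows "qform m A (\<lambda>i. if i = a then x else if i = b then y else 0) =
    cnj x * A a a * x + cnj x * A a b * y + cnj y * A b a * x + cnj y * A b b * y"
proof -
  define v where "v = (\<lambda>i. if i = a then x else if i = b then y else 0)"
  have S: "(\<Sum>i<m. f i) = f a + f b" if "\<And>i. i \<noteq> a \<Longrightarrow> i \<noteq> b \<Longrightarrow> f i = 0" for f :: "nat \<Rightarrow> complex"
  proof -
    have "sum f {..<m} = sum f {a, b}"
      using assms that by (intro sum.mono_neutral_right) auto
    thus ?thesis using assms by simp
  qed
  have va: "v a = x" "v b = y" "\<And>i. i \<noteq> a \<Longrightarrow> i \<noteq> b \<Longrightarrow> v i = 0"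
    using assms by (auto simp: v_def)
  have "qform m A v = (\<Sum>j<m. cnj (v a) * A a j * v j) + (\<Sum>j<m. cnj (v b) * A b j * v j)"
    unfolding qform_def by (rule S) (simp add: va)
  also have "(\<Sum>j<m. cnj (v a) * A a j * v j) = cnj (v a) * A a a * v a + cnj (v a) * A a b * v b"
    by (rule S) (simp add: va)
  also have "(\<Sum>j<m. cnj (v b) * A b j * v j) = cnj (v b) * A b a * v a + cnj (v b) * A b b * v b"
    by (rule S) (simp add: va)
  finally show ?thesis
    unfolding va(1,2) by (simp add: v_def)
qed

lemma qform_unit:
  assumes "a < m"
  shows "qform m A (\<lambda>i. if i = a then 1 else 0) = A a a"
proof -
  have "qform m A (\<lambda>i. if i = a then 1 else 0) = (\<Sum>i<m. (if i = a then 1 else 0) * (\<Sum>b<m. A i b * (if b = a then 1 else 0)))"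
    unfolding qform_def by (simp add: sum_distrib_left if_distrib[of cnj] mult_ac cong: if_cong)
  thus ?thesis by (simp only: sum_delta_mult[OF assms])
qed

text \<open>Polarisation: reality of the form on e_a + e_b relates the imaginary parts of the two
  off-diagonal entries, and on e_a + i e_b their real parts.\<close>

lemma pos_semidef_hermitian:
  assumes "pos_semidef m A"
  shows "hermitian m A"
  unfolding hermitian_def
proof (intro allI impI)
  fix a b assume ab: "a < m" "b < m"
  have real: "Im (qform m A v) = 0" for v
    using assms by (auto simp: pos_semidef_def)
  have diag: "Im (A i i) = 0" if "i < m" for i
    using real[of "\<lambda>k. if k = i then 1 else 0"] qform_unit[OF that] by simp
  show "A a b = cnj (A b a)"
  proof (cases "a = b")
    case True
    thus ?thesis using diag[OF ab(1)] by (simp add: complex_eq_iff)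
  next
    case False
    note q = qform_basis2[OF ab False]
    have "Im (A a b) + Im (A b a) = 0"
      using real[of "\<lambda>i. if i = a then 1 else if i = b then 1 else 0"] diag ab
      unfolding q by simp
    moreover have "Re (A a b) = Re (A b a)"
      using real[of "\<lambda>i. if i = a then 1 else if i = b then \<i> else 0"] diag ab
      unfolding q by simp
    ultimately show ?thesis by (simp add: complex_eq_iff)
  qed
qed

text \<open>Each dyad contributes a squared inner product. The index set and the vectors are
  arbitrary, so the formula serves eigenbases, the pooled eigenvectors of several operators and a
  single projection alike.\<close>

lemma qform_dyads:
  assumes "\<And>a b. a < m \<Longrightarrow> b < m \<Longrightarrow> A a b = (\<Sum>j\<in>J. c j * (x j a * cnj (x j b)))"
  shows "qform m A v = (\<Sum>j\<in>J. c j * of_real ((cmod (\<Sum>a<m. cnj (x j a) * v a))\<^sup>2))"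
proof -
  have "qform m A v = (\<Sum>a<m. \<Sum>b<m. \<Sum>j\<in>J. c j * (cnj (cnj (x j a) * v a) * (cnj (x j b) * v b)))"
    unfolding qform_def using assms
    by (intro sum.cong) (auto simp: sum_distrib_left sum_distrib_right mult_ac)
  also have "\<dots> = (\<Sum>a<m. \<Sum>j\<in>J. \<Sum>b<m. c j * (cnj (cnj (x j a) * v a) * (cnj (x j b) * v b)))"
    by (intro sum.cong refl sum.swap)
  also have "\<dots> = (\<Sum>j\<in>J. \<Sum>a<m. \<Sum>b<m. c j * (cnj (cnj (x j a) * v a) * (cnj (x j b) * v b)))"
    by (rule sum.swap)
  also have "\<dots> = (\<Sum>j\<in>J. c j * (cnj (\<Sum>a<m. cnj (x j a) * v a) * (\<Sum>a<m. cnj (x j a) * v a)))"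
    unfolding cnj_sum sum_product by (simp only: sum_distrib_left)
  also have "\<dots> = (\<Sum>j\<in>J. c j * of_real ((cmod (\<Sum>a<m. cnj (x j a) * v a))\<^sup>2))"
    unfolding complex_norm_square by (simp only: mult.commute)
  finally show ?thesis .
qed

lemma qform_eigdec:
  "eigdec m A u l \<Longrightarrow>
    qform m A v = (\<Sum>j<m. l j * of_real ((cmod (\<Sum>a<m. cnj (u j a) * v a))\<^sup>2))"
  by (rule qform_dyads) (rule eigdecD(2))

text \<open>Both sides are the trace of \<open>A\<close> times the sum of the weighted dyads. Hence
  families with the same sum of dyads can be exchanged.\<close>

lemma sum_qform:
  "(\<Sum>j\<in>J. c j * qform m A (x j)) =
    (\<Sum>a<m. \<Sum>b<m. A a b * (\<Sum>j\<in>J. c j * (x j b * cnj (x j a))))"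
proof -
  have "(\<Sum>j\<in>J. c j * qform m A (x j)) =
    (\<Sum>j\<in>J. \<Sum>a<m. \<Sum>b<m. A a b * (c j * (x j b * cnj (x j a))))"
    unfolding qform_def by (simp add: sum_distrib_left mult_ac)
  also have "\<dots> = (\<Sum>a<m. \<Sum>j\<in>J. \<Sum>b<m. A a b * (c j * (x j b * cnj (x j a))))"
    by (rule sum.swap)
  also have "\<dots> = (\<Sum>a<m. \<Sum>b<m. \<Sum>j\<in>J. A a b * (c j * (x j b * cnj (x j a))))"
    by (intro sum.cong refl sum.swap)
  finally show ?thesis by (simp only: sum_distrib_left)
qed

lemma eigdec_eigenvalue:
  assumes "eigdec m A u l" "j < m"
  shows "l j = qform m A (u j)"
proof -
  have "qform m A (u j) = (\<Sum>i<m. l i * of_real ((cmod (if i = j then 1 else 0))\<^sup>2))"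
    unfolding qform_eigdec[OF assms(1)] using onbD[OF eigdecD(1)[OF assms(1)] _ assms(2)]
    by (intro sum.cong) auto
  also have "\<dots> = (\<Sum>i<m. l i * (if i = j then 1 else 0))"
    by (intro sum.cong) auto
  finally show ?thesis using sum_delta_mult[OF assms(2), of l] by simp
qed

lemma trace_onb:
  assumes "onb m w"
  shows "(\<Sum>j<m. qform m A (w j)) = (\<Sum>a<m. A a a)"
proof -
  have "(\<Sum>j<m. qform m A (w j)) = (\<Sum>a<m. \<Sum>j<m. \<Sum>b<m. cnj (w j a) * A a b * w j b)"
    unfolding qform_def by (rule sum.swap)
  also have "\<dots> = (\<Sum>a<m. \<Sum>b<m. \<Sum>j<m. cnj (w j a) * A a b * w j b)"
    by (intro sum.cong refl sum.swap)
  also have "\<dots> = (\<Sum>a<m. \<Sum>b<m. A a b * (\<Sum>j<m. w j b * cnj (w j a)))"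
    by (simp only: sum_distrib_left mult_ac)
  also have "\<dots> = (\<Sum>a<m. \<Sum>b<m. A a b * (if b = a then 1 else 0))"
    using onb_complete[OF assms] by (intro sum.cong) auto
  also have "\<dots> = (\<Sum>a<m. A a a)"
    by (intro sum.cong refl) (simp add: sum_delta_mult)
  finally show ?thesis .
qed

lemma trace_eigdec:
  assumes "eigdec m A u l"
  shows "(\<Sum>a<m. A a a) = (\<Sum>j<m. l j)"
  using trace_onb[OF eigdecD(1)[OF assms], of A] eigdec_eigenvalue[OF assms] by simp

lemma pos_semidef_eigdec:
  assumes "pos_semidef m A"
  shows "\<exists>u l. eigdec m A u (\<lambda>j. of_real (l j)) \<and> (\<forall>j<m. l j \<ge> 0)"
proof -
  obtain u l where ul: "eigdec m A u (\<lambda>j. of_real (l j))"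
    using spectral_theorem[OF pos_semidef_hermitian[OF assms]] by blast
  have "l j \<ge> 0" if "j < m" for j
    using eigdec_eigenvalue[OF ul that] assms unfolding pos_semidef_def by (metis Re_complex_of_real)
  thus ?thesis using ul by blast
qed

lemma pos_semidef_diag_nonneg:
  assumes "pos_semidef m A" "a < m"
  shows "Im (A a a) = 0" "Re (A a a) \<ge> 0"
  using assms qform_unit[OF assms(2), of A] unfolding pos_semidef_def by metis+

lemma eigdec_apply:
  assumes "eigdec m A u l" "a < m"
  shows "(\<Sum>b<m. A a b * v b) = (\<Sum>j<m. l j * u j a * (\<Sum>b<m. cnj (u j b) * v b))"
proof -
  have "(\<Sum>b<m. A a b * v b) = (\<Sum>b<m. \<Sum>j<m. l j * u j a * (cnj (u j b) * v b))"
    using eigdecD(2)[OF assms] by (intro sum.cong) (auto simp: sum_distrib_left sum_distrib_right mult_ac)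
  also have "\<dots> = (\<Sum>j<m. l j * u j a * (\<Sum>b<m. cnj (u j b) * v b))"
    by (subst sum.swap) (simp only: sum_distrib_left)
  finally show ?thesis .
qed

text \<open>In an eigenbasis the form is a sum of nonnegative terms, so every eigenvector with
  nonzero eigenvalue is orthogonal to \<open>v\<close>.\<close>

lemma pos_semidef_kernel:
  assumes "pos_semidef m A" "qform m A v = 0" "a < m"
  shows "(\<Sum>b<m. A a b * v b) = 0"
proof -
  obtain u l where ul: "eigdec m A u (\<lambda>j. of_real (l j))" "\<And>j. j < m \<Longrightarrow> l j \<ge> 0"
    using pos_semidef_eigdec[OF assms(1)] by blast
  let ?i = "\<lambda>j. \<Sum>b<m. cnj (u j b) * v b"
  have "complex_of_real (\<Sum>j<m. l j * (cmod (?i j))\<^sup>2) = 0"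
    using qform_eigdec[OF ul(1), of v] assms(2) by simp
  hence "(\<Sum>j<m. l j * (cmod (?i j))\<^sup>2) = 0"
    unfolding of_real_eq_0_iff .
  hence "\<forall>j\<in>{..<m}. l j * (cmod (?i j))\<^sup>2 = 0"
    using ul(2) by (subst (asm) sum_nonneg_eq_0_iff) auto
  hence "of_real (l j) * u j a * ?i j = 0" if "j < m" for j
    using that by auto
  thus ?thesis
    unfolding eigdec_apply[OF ul(1) assms(3)] by (intro sum.neutral) auto
qed

section \<open>Bipartite operators\<close>

lemma sum_lessThan_mult:
  fixes f :: "nat \<Rightarrow> 'a::comm_monoid_add"
  shows "(\<Sum>p<d * k. f p) = (\<Sum>s<d. \<Sum>a<k. f (s * k + a))"
proof -
  have "sum f {s * k..<s * k + k} = (\<Sum>a<k. f (s * k + a))" for s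
    using sum.shift_bounds_nat_ivl[of f 0 "s * k" k] by (simp add: atLeast0LessThan add.commute)
  thus ?thesis
    unfolding sum.nat_group[of f k d, symmetric] by simp
qed

lemma mult_add_less:
  fixes s a d k :: nat
  assumes "s < d" "a < k"
  shows "s * k + a < d * k"
proof -
  have "s * k + a < Suc s * k" using assms(2) by simp
  also have "\<dots> \<le> d * k" using assms(1) by (intro mult_le_mono1) simp
  finally show ?thesis .
qed

text \<open>\<open>slice\<close> is \<open>(\<langle>x| \<otimes> I) R (|x\<rangle> \<otimes> I)\<close>, \<open>weighted_ptrace\<close> is \<open>Tr\<^sub>A ((D \<otimes> I) R)\<close>; both, like \<open>ptrace\<close>,
  use the index convention \<open>s * k + a\<close> of \<open>kron\<close>.\<close>
definition slice :: "nat \<Rightarrow> nat \<Rightarrow> (nat \<Rightarrow> nat \<Rightarrow> complex) \<Rightarrow> (nat \<Rightarrow> complex) \<Rightarrow> nat \<Rightarrow> nat \<Rightarrow> complex" where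
  "slice d k R x a b = (\<Sum>s<d. \<Sum>t<d. cnj (x s) * R (s * k + a) (t * k + b) * x t)"

definition ptrace :: "nat \<Rightarrow> (nat \<Rightarrow> nat \<Rightarrow> complex) \<Rightarrow> nat \<Rightarrow> nat \<Rightarrow> complex" where
  "ptrace k R s t = (\<Sum>a<k. R (s * k + a) (t * k + a))"

definition weighted_ptrace ::
  "nat \<Rightarrow> nat \<Rightarrow> (nat \<Rightarrow> nat \<Rightarrow> complex) \<Rightarrow> (nat \<Rightarrow> nat \<Rightarrow> complex) \<Rightarrow> nat \<Rightarrow> nat \<Rightarrow> complex" where
  "weighted_ptrace d k R D a b = (\<Sum>s<d. \<Sum>t<d. D t s * R (s * k + a) (t * k + b))"

text \<open>The vector on the right is the tensor product of \<open>x\<close> and \<open>w\<close>;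
  positivity of \<open>R\<close> on product vectors thus passes to every slice.\<close>

lemma qform_slice:
  "qform k (slice d k R x) w = qform (d * k) R (\<lambda>p. x (p div k) * w (p mod k))"
proof -
  have "qform (d * k) R (\<lambda>p. x (p div k) * w (p mod k)) =
    (\<Sum>s<d. \<Sum>a<k. \<Sum>t<d. \<Sum>b<k. cnj (x s * w a) * R (s * k + a) (t * k + b) * (x t * w b))"
    unfolding qform_def sum_lessThan_mult by (intro sum.cong refl) auto
  also have "\<dots> = (\<Sum>a<k. \<Sum>s<d. \<Sum>b<k. \<Sum>t<d. cnj (x s * w a) * R (s * k + a) (t * k + b) * (x t * w b))"
    by (subst sum.swap) (intro sum.cong refl sum.swap)
  also have "\<dots> = (\<Sum>a<k. \<Sum>b<k. \<Sum>s<d. \<Sum>t<d. cnj (x s * w a) * R (s * k + a) (t * k + b) * (x t * w b))"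
    by (intro sum.cong refl sum.swap)
  also have "\<dots> = qform k (slice d k R x) w"
    unfolding qform_def slice_def by (simp add: sum_distrib_left sum_distrib_right mult_ac)
  finally show ?thesis by simp
qed

lemma pos_semidef_slice:
  "pos_semidef (d * k) R \<Longrightarrow> pos_semidef k (slice d k R x)"
  unfolding pos_semidef_def qform_slice by simp

text \<open>This is how the reduced operator on the first factor enters: for positive
  \<open>R\<close>, its value at \<open>x\<close> is the trace of a positive operator on the second
  factor.\<close>

lemma qform_ptrace:
  "qform d (ptrace k R) x = (\<Sum>a<k. slice d k R x a a)"
proof -
  have "qform d (ptrace k R) x = (\<Sum>s<d. \<Sum>t<d. \<Sum>a<k. cnj (x s) * R (s * k + a) (t * k + a) * x t)"
    unfolding qform_def ptrace_def by (simp add: sum_distrib_left sum_distrib_right)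
  also have "\<dots> = (\<Sum>s<d. \<Sum>a<k. \<Sum>t<d. cnj (x s) * R (s * k + a) (t * k + a) * x t)"
    by (intro sum.cong refl sum.swap)
  also have "\<dots> = (\<Sum>a<k. slice d k R x a a)"
    unfolding slice_def by (rule sum.swap)
  finally show ?thesis .
qed

lemma pos_semidef_ptrace:
  assumes "pos_semidef (d * k) R"
  shows "pos_semidef d (ptrace k R)"
  unfolding pos_semidef_def qform_ptrace Re_sum Im_sum
  using pos_semidef_diag_nonneg[OF pos_semidef_slice[OF assms]]
  by (auto intro!: sum_nonneg sum.neutral)

lemma trace_ptrace: "(\<Sum>s<d. ptrace k R s s) = (\<Sum>p<d * k. R p p)"
  unfolding ptrace_def sum_lessThan_mult ..

lemma hermitian_weighted_ptrace:
  assumes "hermitian (d * k) R" "hermitian d D"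
  shows "hermitian k (weighted_ptrace d k R D)"
  unfolding hermitian_def
proof (intro allI impI)
  fix a b assume ab: "a < k" "b < k"
  have R: "cnj (R p q) = R q p" if "p < d * k" "q < d * k" for p q
    using assms(1) that unfolding hermitian_def by metis
  have D: "cnj (D p q) = D q p" if "p < d" "q < d" for p q
    using assms(2) that unfolding hermitian_def by metis
  have "cnj (weighted_ptrace d k R D b a) = (\<Sum>s<d. \<Sum>t<d. D s t * R (t * k + a) (s * k + b))"
    unfolding weighted_ptrace_def cnj_sum complex_cnj_mult
    using R D ab mult_add_less by (intro sum.cong) auto
  also have "\<dots> = weighted_ptrace d k R D a b"
    unfolding weighted_ptrace_def by (rule sum.swap)
  finally show "weighted_ptrace d k R D a b = cnj (weighted_ptrace d k R D b a)" by simp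
qed

text \<open>\<open>weighted_ptrace\<close> is linear in \<open>D\<close>, and the dyad of
  \<open>u j\<close> contributes the slice at \<open>u j\<close>.\<close>

lemma weighted_ptrace_eigdec:
  assumes "eigdec d D u l"
  shows "weighted_ptrace d k R D a b = (\<Sum>j<d. l j * slice d k R (u j) a b)"
proof -
  have "weighted_ptrace d k R D a b =
    (\<Sum>s<d. \<Sum>t<d. \<Sum>j<d. l j * (cnj (u j s) * R (s * k + a) (t * k + b) * u j t))"
    unfolding weighted_ptrace_def using eigdecD(2)[OF assms]
    by (intro sum.cong) (auto simp: sum_distrib_left sum_distrib_right mult_ac)
  also have "\<dots> = (\<Sum>s<d. \<Sum>j<d. \<Sum>t<d. l j * (cnj (u j s) * R (s * k + a) (t * k + b) * u j t))"
    by (intro sum.cong refl sum.swap)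
  also have "\<dots> = (\<Sum>j<d. \<Sum>s<d. \<Sum>t<d. l j * (cnj (u j s) * R (s * k + a) (t * k + b) * u j t))"
    by (rule sum.swap)
  finally show ?thesis
    unfolding slice_def by (simp only: sum_distrib_left)
qed

lemma qform_sum:
  "qform m (\<lambda>a b. \<Sum>j\<in>J. c j * B j a b) w = (\<Sum>j\<in>J. c j * qform m (B j) w)"
proof -
  have "qform m (\<lambda>a b. \<Sum>j\<in>J. c j * B j a b) w =
    (\<Sum>a<m. \<Sum>b<m. \<Sum>j\<in>J. c j * (cnj (w a) * B j a b * w b))"
    unfolding qform_def by (simp add: sum_distrib_left sum_distrib_right mult_ac)
  also have "\<dots> = (\<Sum>a<m. \<Sum>j\<in>J. \<Sum>b<m. c j * (cnj (w a) * B j a b * w b))"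
    by (intro sum.cong refl sum.swap)
  also have "\<dots> = (\<Sum>j\<in>J. \<Sum>a<m. \<Sum>b<m. c j * (cnj (w a) * B j a b * w b))"
    by (rule sum.swap)
  finally show ?thesis
    unfolding qform_def by (simp only: sum_distrib_left)
qed

text \<open>Evaluated at \<open>w i\<close>, the eigenvalue \<open>\<mu> i\<close> is a combination
  of the \<open>l j\<close> with nonnegative weights, so the triangle inequality replaces each
  \<open>l j\<close> by its absolute value. Summing over \<open>i\<close> turns the weights into
  traces of slices. The right side is the trace of |D| times the reduced operator.\<close>

lemma weighted_ptrace_norm_bound:
  assumes R: "pos_semidef (d * k) R"
    and D: "eigdec d D u (\<lambda>j. of_real (l j))"
    and W: "eigdec k (weighted_ptrace d k R D) w \<mu>"
  shows "(\<Sum>i<k. cmod (\<mu> i)) \<le> (\<Sum>j<d. \<bar>l j\<bar> * Re (qform d (ptrace k R) (u j)))"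
proof -
  have pos: "cmod (qform k (slice d k R x) v) = Re (qform k (slice d k R x) v)" for x v
    using pos_semidef_slice[OF R, of x] unfolding pos_semidef_def
    by (metis cmod_eq_Re abs_of_nonneg)
  have "cmod (\<mu> i) \<le> (\<Sum>j<d. \<bar>l j\<bar> * Re (qform k (slice d k R (u j)) (w i)))" if "i < k" for i
  proof -
    have "\<mu> i = qform k (\<lambda>a b. \<Sum>j<d. of_real (l j) * slice d k R (u j) a b) (w i)"
      unfolding eigdec_eigenvalue[OF W that] weighted_ptrace_eigdec[OF D, abs_def] ..
    also have "\<dots> = (\<Sum>j<d. of_real (l j) * qform k (slice d k R (u j)) (w i))"
      by (rule qform_sum)
    finally have \<mu>: "\<mu> i = (\<Sum>j<d. of_real (l j) * qform k (slice d k R (u j)) (w i))" .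
    show ?thesis
      unfolding \<mu>
      by (rule sum_norm_le) (simp add: norm_mult pos)
  qed
  hence "(\<Sum>i<k. cmod (\<mu> i)) \<le> (\<Sum>i<k. \<Sum>j<d. \<bar>l j\<bar> * Re (qform k (slice d k R (u j)) (w i)))"
    by (intro sum_mono) auto
  also have "\<dots> = (\<Sum>j<d. \<bar>l j\<bar> * Re (\<Sum>i<k. qform k (slice d k R (u j)) (w i)))"
    by (subst sum.swap) (simp add: sum_distrib_left)
  finally show ?thesis
    unfolding trace_onb[OF eigdecD(1)[OF W]] qform_ptrace .
qed

section \<open>Block-diagonal operators\<close>

definition block_diag :: "nat \<Rightarrow> (nat \<Rightarrow> nat \<Rightarrow> nat \<Rightarrow> complex) \<Rightarrow> nat \<Rightarrow> nat \<Rightarrow> complex" where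
  "block_diag k B p q = (if p div k = q div k then B (p div k) (p mod k) (q mod k) else 0)"

lemma sum_if_eq_block:
  fixes F :: "nat \<Rightarrow> nat \<Rightarrow> complex"
  assumes "i < n"
  shows "(\<Sum>s<n. \<Sum>a<k. if s = i then F s a else 0) = (\<Sum>a<k. F i a)"
proof -
  have "(\<Sum>s<n. \<Sum>a<k. if s = i then F s a else 0) = (\<Sum>s<n. if s = i then \<Sum>a<k. F s a else 0)"
    by (intro sum.cong) auto
  thus ?thesis using assms by simp
qed

text \<open>The index \<open>i * k + a\<close> stands for position \<open>a\<close> in block
  \<open>i\<close>. Applied to eigenvectors, \<open>block_diag k u\<close> pads each eigenvector of
  a block with zeros; its first index numbers the eigenvector, its second the coordinate.\<close>

lemma eigdec_block_diag:
  assumes "\<And>i. i < n \<Longrightarrow> eigdec k (B i) (u i) (l i)"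
  shows "eigdec (n * k) (block_diag k B) (block_diag k u) (\<lambda>p. l (p div k) (p mod k))"
  unfolding eigdec_def onb_def
proof (intro conjI allI impI)
  fix p q assume pq: "p < n * k" "q < n * k"
  have k: "k > 0" using pq by (cases k) auto
  have i: "p div k < n" "q div k < n" using pq k by (auto simp: less_mult_imp_div_less)
  have m: "p mod k < k" "q mod k < k" using k by auto
  have "(\<Sum>r<n * k. cnj (block_diag k u p r) * block_diag k u q r) =
    (\<Sum>s<n. \<Sum>a<k. if s = p div k then
        (if p div k = q div k then cnj (u s (p mod k) a) * u s (q mod k) a else 0) else 0)"
    unfolding sum_lessThan_mult using k by (intro sum.cong refl) (auto simp: block_diag_def)
  also have "\<dots> = (\<Sum>a<k. if p div k = q div k then cnj (u (p div k) (p mod k) a) * u (p div k) (q mod k) a else 0)"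
    by (rule sum_if_eq_block[OF i(1)])
  also have "\<dots> = (if p div k = q div k \<and> p mod k = q mod k then 1 else 0)"
    using onbD[OF eigdecD(1)[OF assms[OF i(1)]] m] by (cases "p div k = q div k") auto
  also have "p div k = q div k \<and> p mod k = q mod k \<longleftrightarrow> p = q"
    by (metis div_mult_mod_eq)
  finally show "(\<Sum>r<n * k. cnj (block_diag k u p r) * block_diag k u q r) = (if p = q then 1 else 0)" .
  have "(\<Sum>r<n * k. l (r div k) (r mod k) * (block_diag k u r p * cnj (block_diag k u r q))) =
    (\<Sum>s<n. \<Sum>a<k. if s = p div k then
        (if p div k = q div k then l s a * (u s a (p mod k) * cnj (u s a (q mod k))) else 0) else 0)"
    unfolding sum_lessThan_mult using k by (intro sum.cong refl) (auto simp: block_diag_def)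
  also have "\<dots> = (\<Sum>a<k. if p div k = q div k then
      l (p div k) a * (u (p div k) a (p mod k) * cnj (u (p div k) a (q mod k))) else 0)"
    by (rule sum_if_eq_block[OF i(1)])
  also have "\<dots> = block_diag k B p q"
    using eigdecD(2)[OF assms[OF i(1)] m] by (auto simp: block_diag_def)
  finally show "block_diag k B p q =
    (\<Sum>r<n * k. l (r div k) (r mod k) * (block_diag k u r p * cnj (block_diag k u r q)))" by simp
qed

lemma eigdec_cong:
  "(\<And>a b. a < m \<Longrightarrow> b < m \<Longrightarrow> A a b = B a b) \<Longrightarrow> eigdec m A u l \<Longrightarrow> eigdec m B u l"
  unfolding eigdec_def by auto

lemma trace_norm_block_diag:
  assumes X: "X \<in> carrier_mat (n * k) (n * k)"
    and XB: "\<And>p q. p < n * k \<Longrightarrow> q < n * k \<Longrightarrow> X $$ (p, q) = block_diag k B p q"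
    and B: "\<And>i. i < n \<Longrightarrow> eigdec k (B i) (u i) (l i)"
  shows "trace_norm X = (\<Sum>i<n. \<Sum>j<k. cmod (l i j))"
proof -
  have "eigdec (n * k) (\<lambda>p q. X $$ (p, q)) (block_diag k u) (\<lambda>p. l (p div k) (p mod k))"
    by (rule eigdec_cong[OF _ eigdec_block_diag[OF B]]) (auto simp: XB)
  from trace_norm_eigdec[OF X this]
  show ?thesis unfolding sum_lessThan_mult by (auto intro!: sum.cong)
qed

text \<open>The first conjunct bounds the value of every input by an eigenvalue \<open>p\<close> of
  \<open>P = \<Sum>\<^sub>i |D\<^sub>i|\<close>; if \<open>p\<close> reaches the trace of \<open>P\<close>, then \<open>P\<close> has rank one, hence so
  has every \<open>D\<^sub>i\<close>.\<close>
lemma sum_abs_top_eigenvector: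
  fixes n :: nat
  assumes d: "d \<ge> 1"
    and dec: "\<And>i. i < n \<Longrightarrow> eigdec d (D i) (u i) (\<lambda>j. of_real (l i j))"
  shows "\<exists>w p. (\<forall>A. pos_semidef d A \<and> (\<Sum>a<d. A a a) = 1 \<longrightarrow>
            (\<Sum>i<n. \<Sum>j<d. \<bar>l i j\<bar> * Re (qform d A (u i j))) \<le> p) \<and>
         (\<Sum>a<d. cnj (w a) * w a) = 1 \<and>
         ((\<Sum>i<n. \<Sum>j<d. \<bar>l i j\<bar>) \<le> p \<longrightarrow>
            (\<forall>i<n. \<exists>\<gamma>. \<forall>a<d. \<forall>b<d. D i a b = \<gamma> * (w a * cnj (w b))))"
proof -
  define J where "J = {..<n} \<times> {..<d}"
  define c where "c = (\<lambda>(i, j). \<bar>l i j\<bar>)"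
  define x where "x = (\<lambda>(i, j). u i j)"
  \<comment> \<open>\<open>J\<close> pools the eigenvectors of all \<open>D i\<close>, and
    \<open>P\<close> is the sum of the operators |D_i|.\<close>
  define P where "P a b = (\<Sum>z\<in>J. of_real (c z) * (x z a * cnj (x z b)))" for a b
  have J: "finite J" by (simp add: J_def)
  have c0: "c z \<ge> 0" for z by (auto simp: c_def split: prod.split)
  have sumJ: "(\<Sum>i<n. \<Sum>j<d. F i j) = (\<Sum>z\<in>J. case z of (i, j) \<Rightarrow> F i j)" for F :: "nat \<Rightarrow> nat \<Rightarrow> real"
    unfolding J_def by (rule sum.cartesian_product)
  have qP: "qform d P v = of_real (\<Sum>z\<in>J. c z * (cmod (\<Sum>a<d. cnj (x z a) * v a))\<^sup>2)" for v
    using qform_dyads[where m = d and A = P and J = J and c = "\<lambda>z. of_real (c z)" and x = x and v = v] by (simp add: P_def)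
  have "pos_semidef d P"
    unfolding pos_semidef_def qP using c0 by (auto intro!: sum_nonneg)
  then obtain w p where w: "eigdec d P w (\<lambda>j. of_real (p j))" and p0: "\<And>j. j < d \<Longrightarrow> p j \<ge> 0"
    using pos_semidef_eigdec by blast
  note ow = eigdecD(1)[OF w]
  \<comment> \<open>Each \<open>x z\<close> with \<open>z\<close> in \<open>J\<close> has norm one,
    so the trace of \<open>P\<close> is the sum of all \<open>\<bar>l i j\<bar>\<close>.\<close>
  have "complex_of_real (\<Sum>j<d. p j) = (\<Sum>a<d. P a a)"
    using trace_eigdec[OF w] by simp
  also have "\<dots> = (\<Sum>z\<in>J. of_real (c z) * (\<Sum>a<d. cnj (x z a) * x z a))"
    unfolding P_def by (subst sum.swap) (simp add: sum_distrib_left mult_ac)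
  also have "\<dots> = (\<Sum>z\<in>J. of_real (c z))"
  proof (intro sum.cong refl)
    fix z assume "z \<in> J"
    then obtain i j where "z = (i, j)" "i < n" "j < d" by (auto simp: J_def)
    thus "of_real (c z) * (\<Sum>a<d. cnj (x z a) * x z a) = complex_of_real (c z)"
      using onbD[OF eigdecD(1)[OF dec], of i j j] by (simp add: x_def)
  qed
  finally have trP: "(\<Sum>j<d. p j) = (\<Sum>z\<in>J. c z)"
    by (simp flip: of_real_sum)
  \<comment> \<open>\<open>q\<close> is the largest eigenvalue of \<open>P\<close>, with eigenvector
    \<open>w r\<close>; the maximum exists because \<open>d\<close> is positive.\<close>
  define q where "q = Max (p ` {..<d})"
  have ne: "p ` {..<d} \<noteq> {}" using d by (auto simp: lessThan_empty_iff)
  obtain r where r: "r < d" "p r = q"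
    using Max_in[OF _ ne] unfolding q_def by auto
  have pq: "p j \<le> q" if "j < d" for j
    using that unfolding q_def by simp
  have bound: "(\<Sum>i<n. \<Sum>j<d. \<bar>l i j\<bar> * Re (qform d A (u i j))) \<le> q"
    if A: "pos_semidef d A" "(\<Sum>a<d. A a a) = 1" for A
  proof -
    \<comment> \<open>The sum is the trace of \<open>A\<close> times \<open>P\<close>;
      \<open>sum_qform\<close> is then used backwards to rewrite it in the eigenbasis of
      \<open>P\<close>, where each eigenvalue is at most \<open>q\<close>.\<close>
    have "(\<Sum>i<n. \<Sum>j<d. \<bar>l i j\<bar> * Re (qform d A (u i j))) = Re (\<Sum>z\<in>J. of_real (c z) * qform d A (x z))"
      unfolding sumJ Re_sum by (intro sum.cong refl) (auto simp: c_def x_def)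
    also have "(\<Sum>z\<in>J. of_real (c z) * qform d A (x z)) = (\<Sum>a<d. \<Sum>b<d. A a b * P b a)"
      unfolding sum_qform P_def ..
    also have "\<dots> = (\<Sum>a<d. \<Sum>b<d. A a b * (\<Sum>j<d. of_real (p j) * (w j b * cnj (w j a))))"
      using eigdecD(2)[OF w] by (intro sum.cong refl) auto
    also have "\<dots> = (\<Sum>j<d. of_real (p j) * qform d A (w j))"
      unfolding sum_qform ..
    also have "Re \<dots> = (\<Sum>j<d. p j * Re (qform d A (w j)))"
      by simp
    also have "\<dots> \<le> (\<Sum>j<d. q * Re (qform d A (w j)))"
      using pq A(1) by (intro sum_mono mult_right_mono) (auto simp: pos_semidef_def)
    also have "\<dots> = q * Re (\<Sum>j<d. qform d A (w j))"
      by (simp add: sum_distrib_left)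
    also have "\<dots> = q"
      unfolding trace_onb[OF ow] A(2) by simp
    finally show ?thesis .
  qed
  have rank1: "\<exists>\<gamma>. \<forall>a<d. \<forall>b<d. D i a b = \<gamma> * (w r a * cnj (w r b))"
    if le: "(\<Sum>i<n. \<Sum>j<d. \<bar>l i j\<bar>) \<le> q" and i: "i < n" for i
  proof -
    \<comment> \<open>The trace of \<open>P\<close> is at most its largest eigenvalue; as the
      eigenvalues are nonnegative, all others vanish.\<close>
    have "(\<Sum>j<d. p j) \<le> p r"
      using le unfolding trP sumJ r c_def .
    moreover have "(\<Sum>j<d. p j) = p r + (\<Sum>j\<in>{..<d} - {r}. p j)"
      using r by (subst sum.remove[of _ r]) auto
    ultimately have "(\<Sum>j\<in>{..<d} - {r}. p j) \<le> 0" by simp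
    moreover have "(\<Sum>j\<in>{..<d} - {r}. p j) \<ge> 0"
      using p0 by (intro sum_nonneg) auto
    ultimately have "(\<Sum>j\<in>{..<d} - {r}. p j) = 0" by simp
    hence pz: "p j = 0" if "j < d" "j \<noteq> r" for j
      using p0 that by (subst (asm) sum_nonneg_eq_0_iff) auto
    \<comment> \<open>Where the form of \<open>P\<close> vanishes, the vector is orthogonal to every
      eigenvector of \<open>D i\<close> with nonzero eigenvalue, so \<open>D i\<close> annihilates
      it.\<close>
    have Dw: "(\<Sum>b<d. D i a b * w j b) = 0" if "j < d" "j \<noteq> r" "a < d" for j a
    proof -
      have "complex_of_real (\<Sum>z\<in>J. c z * (cmod (\<Sum>a<d. cnj (x z a) * w j a))\<^sup>2) = 0"
        using eigdec_eigenvalue[OF w that(1)] pz[OF that(1,2)] unfolding qP by simp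
      hence "(\<Sum>z\<in>J. c z * (cmod (\<Sum>a<d. cnj (x z a) * w j a))\<^sup>2) = 0"
        unfolding of_real_eq_0_iff .
      hence z: "\<forall>z\<in>J. c z * (cmod (\<Sum>a<d. cnj (x z a) * w j a))\<^sup>2 = 0"
        using J c0 by (subst (asm) sum_nonneg_eq_0_iff) auto
      have "of_real (l i k) * u i k a * (\<Sum>b<d. cnj (u i k b) * w j b) = 0" if "k < d" for k
        using bspec[OF z, of "(i, k)"] i that by (auto simp: J_def c_def x_def)
      thus ?thesis
        unfolding eigdec_apply[OF dec[OF i] that(3)] by (intro sum.neutral) auto
    qed
    \<comment> \<open>Expanding along \<open>w\<close> leaves only \<open>w r\<close> on the right;
      hermiticity then does the same on the left.\<close>
    have Dr: "D i a b = (\<Sum>e<d. D i a e * w r e) * cnj (w r b)" if "a < d" "b < d" for a b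
    proof -
      have "D i a b = (\<Sum>j<d. (\<Sum>e<d. D i a e * w j e) * cnj (w j b))"
        by (rule onb_expand_right[OF ow that(2), symmetric])
      also have "\<dots> = (\<Sum>j\<in>{r}. (\<Sum>e<d. D i a e * w j e) * cnj (w j b))"
        using r(1) Dw that by (intro sum.mono_neutral_right) auto
      finally show ?thesis by simp
    qed
    have herm: "D i a b = cnj (D i b a)" if "a < d" "b < d" for a b
      using eigdecD(2)[OF dec[OF i]] that by (simp add: mult_ac)
    \<comment> \<open>The inner product of \<open>D i\<close> applied to \<open>w r\<close> with
      \<open>w r\<close>, which is the eigenvalue of \<open>D i\<close> at
      \<open>w r\<close>.\<close>
    define \<gamma> where "\<gamma> = (\<Sum>e<d. cnj (\<Sum>f<d. D i e f * w r f) * w r e)"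
    have "D i a b = \<gamma> * (w r a * cnj (w r b))" if ab: "a < d" "b < d" for a b
    proof -
      have "(\<Sum>e<d. D i a e * w r e) = (\<Sum>e<d. w r a * (cnj (\<Sum>f<d. D i e f * w r f) * w r e))"
      proof (intro sum.cong refl)
        fix e assume "e \<in> {..<d}"
        hence e: "e < d" by simp
        have "D i a e = cnj ((\<Sum>f<d. D i e f * w r f) * cnj (w r a))"
          using herm[OF ab(1) e] Dr[OF e ab(1)] by metis
        thus "D i a e * w r e = w r a * (cnj (\<Sum>f<d. D i e f * w r f) * w r e)"
          by (simp only: complex_cnj_mult complex_cnj_cnj mult_ac)
      qed
      hence "(\<Sum>e<d. D i a e * w r e) = w r a * \<gamma>"
        unfolding \<gamma>_def sum_distrib_left .
      thus ?thesis using Dr[OF ab] by (simp add: mult_ac)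
    qed
    thus ?thesis by blast
  qed
  have "(\<Sum>a<d. cnj (w r a) * w r a) = 1"
    using onbD[OF ow r(1) r(1)] by simp
  thus ?thesis
    using bound rank1 by (intro exI[of _ "w r"] exI[of _ q]) blast
qed

section \<open>Measurement channels\<close>

text \<open>The indices come out swapped; this is why \<open>weighted_ptrace\<close> uses
  \<open>D t s\<close> and why the Choi blocks are transposed.\<close>

lemma mtrace_ket_bra_mult:
  assumes "A \<in> carrier_mat d d" "s < d" "t < d"
  shows "mtrace (ket_bra d s t * A) = A $$ (t, s)"
proof -
  have "mtrace (ket_bra d s t * A) =
    (\<Sum>i<d. (if i = s then 1 else 0) * (\<Sum>b<d. (if b = t then 1 else 0) * A $$ (b, i)))"
    using assms unfolding mtrace_def
    by (auto simp: ket_bra_def scalar_prod_def atLeast0LessThan intro!: sum.cong)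
  thus ?thesis by (simp only: sum_delta_mult assms)
qed

lemma meas_channel_carrier: "meas_channel n M \<sigma> \<in> carrier_mat n n"
  by (simp add: meas_channel_def)

lemma meas_diff_ket_bra:
  assumes "M i \<in> carrier_mat d d" "N i \<in> carrier_mat d d" "s < d" "t < d" "i < n" "j < n"
  shows "(meas_channel n M (ket_bra d s t) - meas_channel n N (ket_bra d s t)) $$ (i, j) =
    (if i = j then M i $$ (t, s) - N i $$ (t, s) else 0)"
  using assms mtrace_ket_bra_mult[OF assms(1,3,4)] mtrace_ket_bra_mult[OF assms(2,3,4)]
  by (auto simp: meas_channel_def)

text \<open>Measurement channels have diagonal output, so only diagonal blocks survive in the tensor
  product, one for each outcome.\<close>

lemma tensor_id_apply_meas_diff:
  assumes "\<And>i. i < n \<Longrightarrow> M i \<in> carrier_mat d d" "\<And>i. i < n \<Longrightarrow> N i \<in> carrier_mat d d"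
  defines "S \<equiv> \<lambda>\<sigma>. meas_channel n M \<sigma> - meas_channel n N \<sigma>"
  shows "tensor_id_apply d k S \<rho> \<in> carrier_mat (n * k) (n * k)"
    and "\<And>p q. p < n * k \<Longrightarrow> q < n * k \<Longrightarrow> tensor_id_apply d k S \<rho> $$ (p, q) =
      block_diag k (\<lambda>i. weighted_ptrace d k (\<lambda>a b. \<rho> $$ (a, b)) (\<lambda>s t. M i $$ (s, t) - N i $$ (s, t))) p q"
proof -
  have dim: "dim_row (S \<sigma>) = n" "dim_col (S \<sigma>) = n" for \<sigma>
    using meas_channel_carrier[of n N \<sigma>] by (auto simp: S_def)
  show "tensor_id_apply d k S \<rho> \<in> carrier_mat (n * k) (n * k)"
    by (simp add: tensor_id_apply_def dim)
  fix p q assume pq: "p < n * k" "q < n * k"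
  have k: "k > 0" using pq by (cases k) auto
  have i: "p div k < n" "q div k < n" using pq k by (auto simp: less_mult_imp_div_less)
  have "tensor_id_apply d k S \<rho> $$ (p, q) =
    (\<Sum>s<d. \<Sum>t<d. kron (S (ket_bra d s t)) (block k \<rho> s t) $$ (p, q))"
    using pq by (simp add: tensor_id_apply_def dim)
  also have "\<dots> = (\<Sum>s<d. \<Sum>t<d. (if p div k = q div k then
      (M (p div k) $$ (t, s) - N (p div k) $$ (t, s)) * \<rho> $$ (s * k + p mod k, t * k + q mod k) else 0))"
  proof (intro sum.cong refl)
    fix s t assume "s \<in> {..<d}" "t \<in> {..<d}"
    hence st: "s < d" "t < d" by auto
    have "kron (S (ket_bra d s t)) (block k \<rho> s t) $$ (p, q) =
      S (ket_bra d s t) $$ (p div k, q div k) * \<rho> $$ (s * k + p mod k, t * k + q mod k)"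
      using pq k by (simp add: kron_def dim block_def)
    thus "kron (S (ket_bra d s t)) (block k \<rho> s t) $$ (p, q) = (if p div k = q div k then
      (M (p div k) $$ (t, s) - N (p div k) $$ (t, s)) * \<rho> $$ (s * k + p mod k, t * k + q mod k) else 0)"
      unfolding S_def meas_diff_ket_bra[where M = M and N = N, OF assms(1,2)[OF i(1)] st i] by simp
  qed
  also have "\<dots> = block_diag k (\<lambda>i. weighted_ptrace d k (\<lambda>a b. \<rho> $$ (a, b)) (\<lambda>s t. M i $$ (s, t) - N i $$ (s, t))) p q"
    by (simp add: block_diag_def weighted_ptrace_def)
  finally show "tensor_id_apply d k S \<rho> $$ (p, q) =
      block_diag k (\<lambda>i. weighted_ptrace d k (\<lambda>a b. \<rho> $$ (a, b)) (\<lambda>s t. M i $$ (s, t) - N i $$ (s, t))) p q" .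
qed

text \<open>The factor \<open>ket_bra d s t\<close> selects a single pair \<open>(s, t)\<close> for
  each entry, so no sum remains in the blocks.\<close>

lemma choi_meas_diff:
  assumes "\<And>i. i < n \<Longrightarrow> M i \<in> carrier_mat d d" "\<And>i. i < n \<Longrightarrow> N i \<in> carrier_mat d d"
  defines "S \<equiv> \<lambda>\<sigma>. meas_channel n M \<sigma> - meas_channel n N \<sigma>"
  shows "choi d S \<in> carrier_mat (n * d) (n * d)"
    and "\<And>p q. p < n * d \<Longrightarrow> q < n * d \<Longrightarrow> choi d S $$ (p, q) =
      block_diag d (\<lambda>i a b. M i $$ (b, a) - N i $$ (b, a)) p q"
proof -
  have dim: "dim_row (S \<sigma>) = n" "dim_col (S \<sigma>) = n" for \<sigma>
    using meas_channel_carrier[of n N \<sigma>] by (auto simp: S_def)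
  show "choi d S \<in> carrier_mat (n * d) (n * d)"
    by (simp add: choi_def dim)
  fix p q assume pq: "p < n * d" "q < n * d"
  have d: "d > 0" using pq by (cases d) auto
  have i: "p div d < n" "q div d < n" using pq d by (auto simp: less_mult_imp_div_less)
  have m: "p mod d < d" "q mod d < d" using d by auto
  define F where "F s t = (if p div d = q div d then M (p div d) $$ (t, s) - N (p div d) $$ (t, s) else 0)" for s t
  have "choi d S $$ (p, q) =
    (\<Sum>s<d. \<Sum>t<d. kron (S (ket_bra d s t)) (ket_bra d s t) $$ (p, q))"
    using pq by (simp add: choi_def dim)
  also have "\<dots> = (\<Sum>s<d. (if s = p mod d then 1 else 0) * (\<Sum>t<d. (if t = q mod d then 1 else 0) * F s t))"
    unfolding sum_distrib_left
  proof (intro sum.cong refl)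
    fix s t assume "s \<in> {..<d}" "t \<in> {..<d}"
    hence st: "s < d" "t < d" by auto
    have "kron (S (ket_bra d s t)) (ket_bra d s t) $$ (p, q) =
      S (ket_bra d s t) $$ (p div d, q div d) * (if p mod d = s \<and> q mod d = t then 1 else 0)"
      using pq d by (simp add: kron_def dim ket_bra_def)
    thus "kron (S (ket_bra d s t)) (ket_bra d s t) $$ (p, q) =
      (if s = p mod d then 1 else 0) * ((if t = q mod d then 1 else 0) * F s t)"
      unfolding S_def meas_diff_ket_bra[where M = M and N = N, OF assms(1,2)[OF i(1)] st i]
      by (auto simp: F_def)
  qed
  also have "\<dots> = F (p mod d) (q mod d)"
    by (simp only: sum_delta_mult m)
  finally show "choi d S $$ (p, q) = block_diag d (\<lambda>i a b. M i $$ (b, a) - N i $$ (b, a)) p q"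
    by (simp add: F_def block_diag_def)
qed

lemma eigdec_scale_transpose:
  assumes "eigdec m A u l"
  shows "eigdec m (\<lambda>a b. c * A b a) (\<lambda>j a. cnj (u j a)) (\<lambda>j. c * l j)"
  unfolding eigdec_def onb_def
proof (intro conjI allI impI)
  fix j k assume jk: "j < m" "k < m"
  have "(\<Sum>a<m. cnj (cnj (u j a)) * cnj (u k a)) = cnj (\<Sum>a<m. cnj (u j a) * u k a)"
    by simp
  also have "\<dots> = (if j = k then 1 else 0)"
    unfolding onbD[OF eigdecD(1)[OF assms] jk] by simp
  finally show "(\<Sum>a<m. cnj (cnj (u j a)) * cnj (u k a)) = (if j = k then 1 else 0)" .
  show "c * A k j = (\<Sum>i<m. c * l i * (cnj (u i j) * cnj (cnj (u i k))))"
    unfolding eigdecD(2)[OF assms jk(2,1)] by (simp add: sum_distrib_left mult_ac)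
qed

lemma eigdec_scale:
  assumes "eigdec m A u l"
  shows "eigdec m (\<lambda>a b. c * A a b) u (\<lambda>j. c * l j)"
  using assms unfolding eigdec_def by (simp add: sum_distrib_left mult.assoc)

text \<open>Conjugating the eigenvectors diagonalises a transpose with the same eigenvalues, so the
  transposed Choi blocks have the trace norms of the differences; the factor \<open>d\<close>
  cancels the normalisation.\<close>

lemma me_norm_meas_diff:
  assumes d: "d \<ge> 1"
    and car: "\<And>i. i < n \<Longrightarrow> M i \<in> carrier_mat d d" "\<And>i. i < n \<Longrightarrow> N i \<in> carrier_mat d d"
    and dec: "\<And>i. i < n \<Longrightarrow> eigdec d (\<lambda>s t. M i $$ (s, t) - N i $$ (s, t)) (u i) (l i)"
  shows "of_nat d * me_norm d (\<lambda>\<sigma>. meas_channel n M \<sigma> - meas_channel n N \<sigma>) =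
    (\<Sum>i<n. \<Sum>j<d. cmod (l i j))"
proof -
  note C = choi_meas_diff[where M = M and N = N and n = n and d = d, OF car, simplified]
  have "me_norm d (\<lambda>\<sigma>. meas_channel n M \<sigma> - meas_channel n N \<sigma>) =
    (\<Sum>i<n. \<Sum>j<d. cmod (1 / of_nat d * l i j))"
    unfolding me_norm_def
  proof (rule trace_norm_block_diag)
    show "(1 / of_nat d) \<cdot>\<^sub>m choi d (\<lambda>\<sigma>. meas_channel n M \<sigma> - meas_channel n N \<sigma>) \<in> carrier_mat (n * d) (n * d)"
      using C(1) by simp
    show "eigdec d (\<lambda>a b. 1 / of_nat d * (M i $$ (b, a) - N i $$ (b, a)))
        (\<lambda>j a. cnj (u i j a)) (\<lambda>j. 1 / of_nat d * l i j)" if "i < n" for i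
      by (rule eigdec_scale_transpose[OF dec[OF that]])
    show "((1 / of_nat d) \<cdot>\<^sub>m choi d (\<lambda>\<sigma>. meas_channel n M \<sigma> - meas_channel n N \<sigma>)) $$ (p, q) =
        block_diag d (\<lambda>i a b. 1 / of_nat d * (M i $$ (b, a) - N i $$ (b, a))) p q"
      if "p < n * d" "q < n * d" for p q
    proof -
      have "((1 / of_nat d) \<cdot>\<^sub>m choi d (\<lambda>\<sigma>. meas_channel n M \<sigma> - meas_channel n N \<sigma>)) $$ (p, q) =
        1 / of_nat d * choi d (\<lambda>\<sigma>. meas_channel n M \<sigma> - meas_channel n N \<sigma>) $$ (p, q)"
        using C(1) that by (intro index_smult_mat) auto
      thus ?thesis
        unfolding C(2)[OF that] by (simp add: block_diag_def)
    qed
  qed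
  also have "\<dots> = 1 / real d * (\<Sum>i<n. \<Sum>j<d. cmod (l i j))"
    by (simp add: norm_mult norm_divide sum_distrib_left)
  finally show ?thesis using d by simp
qed

section \<open>Differences proportional to a single projection\<close>

lemma unit_vector_onb:
  assumes d: "d \<ge> 1" and \<phi>: "unit_vector d \<phi>"
  shows "\<exists>u. onb d u \<and> (\<forall>a<d. \<forall>b<d. u 0 a * cnj (u 0 b) = \<phi> $ a * cnj (\<phi> $ b))"
proof -
  have car: "\<phi> \<in> carrier_vec d" and nrm: "(\<Sum>i<d. (cmod (\<phi> $ i))\<^sup>2) = 1"
    using \<phi> by (auto simp: unit_vector_def)
  have "\<phi> \<noteq> 0\<^sub>v d"
    using nrm by auto
  then obtain u c where u: "onb d u" and uc: "\<And>a. a < d \<Longrightarrow> u 0 a = c * \<phi> $ a"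
    using onb_extends[OF car] by blast
  have "(\<Sum>a<d. cnj (u 0 a) * u 0 a) = (\<Sum>a<d. (c * cnj c) * of_real ((cmod (\<phi> $ a))\<^sup>2))"
    using uc unfolding complex_norm_square by (intro sum.cong) auto
  also have "\<dots> = (c * cnj c) * of_real (\<Sum>a<d. (cmod (\<phi> $ a))\<^sup>2)"
    by (simp only: sum_distrib_left of_real_sum)
  \<comment> \<open>Both vectors have norm one, so \<open>u 0\<close> equals \<open>\<phi>\<close>
    up to a phase, and the phase drops out of the dyad.\<close>
  finally have "c * cnj c = 1"
    using onbD[OF u, of 0 0] d unfolding nrm by simp
  hence "u 0 a * cnj (u 0 b) = \<phi> $ a * cnj (\<phi> $ b)" if "a < d" "b < d" for a b
    using uc that by (simp add: mult_ac)
  thus ?thesis using u by blast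
qed

lemma unit_vector_proj_dyad:
  assumes "unit_vector d \<phi>" "a < d" "b < d"
  shows "proj \<phi> $$ (a, b) = \<phi> $ a * cnj (\<phi> $ b)"
  using assms by (auto simp: proj_def unit_vector_def)

lemma density_proj:
  assumes "unit_vector m \<psi>"
  shows "density m (proj \<psi>)"
proof -
  have dim: "dim_vec \<psi> = m" using assms by (auto simp: unit_vector_def)
  have car: "proj \<psi> \<in> carrier_mat m m" by (simp add: proj_def dim)
  have "qform m (\<lambda>a b. proj \<psi> $$ (a, b)) v = of_real ((cmod (\<Sum>a<m. cnj (\<psi> $ a) * v a))\<^sup>2)" for v
    using qform_dyads[where m = m and A = "\<lambda>a b. proj \<psi> $$ (a, b)" and J = "{()}" and c = "\<lambda>_. 1"
        and x = "\<lambda>_ a. \<psi> $ a" and v = v]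
    by (simp add: unit_vector_proj_dyad[OF assms])
  hence "psd m (proj \<psi>)"
    unfolding psd_iff_pos_semidef pos_semidef_def using car by simp
  moreover have "mtrace (proj \<psi>) = of_real (\<Sum>i<m. (cmod (\<psi> $ i))\<^sup>2)"
    unfolding mtrace_def of_real_sum complex_norm_square by (simp add: proj_def dim)
  ultimately show ?thesis
    using assms by (simp only: density_def unit_vector_def) simp
qed

lemma density_pos_semidef:
  assumes "density m \<rho>"
  shows "pos_semidef m (\<lambda>a b. \<rho> $$ (a, b))" "(\<Sum>a<m. \<rho> $$ (a, a)) = 1" "\<rho> \<in> carrier_mat m m"
  using assms unfolding density_def psd_iff_pos_semidef mtrace_def by auto

lemma weighted_ptrace_dyad:
  assumes "\<And>s t. s < d \<Longrightarrow> t < d \<Longrightarrow> D s t = \<gamma> * (x s * cnj (x t))"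
  shows "weighted_ptrace d k R D a b = \<gamma> * slice d k R x a b"
proof -
  have "weighted_ptrace d k R D a b =
    (\<Sum>s<d. \<Sum>t<d. \<gamma> * (cnj (x s) * R (s * k + a) (t * k + b) * x t))"
    unfolding weighted_ptrace_def using assms by (intro sum.cong) auto
  thus ?thesis
    unfolding slice_def by (simp only: sum_distrib_left)
qed

text \<open>Every block is \<open>\<gamma> i\<close> times the same positive slice, so its trace
  norm is the modulus of \<open>\<gamma> i\<close> times the trace of that slice.\<close>

lemma trace_norm_rank_one:
  assumes car: "\<And>i. i < n \<Longrightarrow> M i \<in> carrier_mat d d" "\<And>i. i < n \<Longrightarrow> N i \<in> carrier_mat d d"
    and D: "\<And>i s t. i < n \<Longrightarrow> s < d \<Longrightarrow> t < d \<Longrightarrow> M i $$ (s, t) - N i $$ (s, t) = \<gamma> i * (x s * cnj (x t))"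
    and \<rho>: "pos_semidef (d * k) (\<lambda>a b. \<rho> $$ (a, b))"
  shows "trace_norm (tensor_id_apply d k (\<lambda>\<sigma>. meas_channel n M \<sigma> - meas_channel n N \<sigma>) \<rho>) =
    (\<Sum>i<n. cmod (\<gamma> i)) * Re (qform d (ptrace k (\<lambda>a b. \<rho> $$ (a, b))) x)"
proof -
  let ?R = "\<lambda>a b. \<rho> $$ (a, b)"
  note T = tensor_id_apply_meas_diff[where M = M and N = N and n = n and d = d and k = k and \<rho> = \<rho>, OF car, simplified]
  obtain w t where w: "eigdec k (slice d k ?R x) w (\<lambda>j. of_real (t j))" and t: "\<And>j. j < k \<Longrightarrow> t j \<ge> 0"
    using pos_semidef_eigdec[OF pos_semidef_slice[OF \<rho>]] by blast
  have "trace_norm (tensor_id_apply d k (\<lambda>\<sigma>. meas_channel n M \<sigma> - meas_channel n N \<sigma>) \<rho>) =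
    (\<Sum>i<n. \<Sum>j<k. cmod (\<gamma> i * of_real (t j)))"
  proof (rule trace_norm_block_diag[OF T])
    show "eigdec k (weighted_ptrace d k ?R (\<lambda>s t. M i $$ (s, t) - N i $$ (s, t))) w
        (\<lambda>j. \<gamma> i * of_real (t j))" if "i < n" for i
      by (rule eigdec_cong[OF _ eigdec_scale[OF w]])
         (rule weighted_ptrace_dyad[symmetric], rule D[OF that])
  qed
  also have "\<dots> = (\<Sum>i<n. cmod (\<gamma> i)) * (\<Sum>j<k. t j)"
    unfolding sum_product using t by (intro sum.cong refl) (auto simp: norm_mult)
  also have "(\<Sum>j<k. t j) = Re (qform d (ptrace k ?R) x)"
    unfolding qform_ptrace trace_eigdec[OF w] by simp
  finally show ?thesis .
qed

text \<open>In the basis \<open>u\<close> the trace is a sum of nonnegative diagonal values; if the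
  first one already reaches the trace, the others vanish.\<close>

lemma qform_le_trace:
  assumes A: "pos_semidef d A" and u: "onb d u" and d: "d \<ge> 1"
  shows "Re (qform d A (u 0)) \<le> Re (\<Sum>a<d. A a a)"
    and "\<lbrakk>Re (qform d A (u 0)) = Re (\<Sum>a<d. A a a); j < d; j \<noteq> 0\<rbrakk> \<Longrightarrow> qform d A (u j) = 0"
proof -
  have nn: "Re (qform d A (u j)) \<ge> 0" "Im (qform d A (u j)) = 0" for j
    using A by (auto simp: pos_semidef_def)
  have eq: "Re (\<Sum>a<d. A a a) = Re (qform d A (u 0)) + (\<Sum>j\<in>{..<d} - {0}. Re (qform d A (u j)))"
    unfolding trace_onb[OF u, symmetric] Re_sum using d by (subst sum.remove[of _ 0]) auto
  show "Re (qform d A (u 0)) \<le> Re (\<Sum>a<d. A a a)"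
    unfolding eq using nn by (simp add: sum_nonneg)
  assume *: "Re (qform d A (u 0)) = Re (\<Sum>a<d. A a a)" "j < d" "j \<noteq> 0"
  hence "(\<Sum>j\<in>{..<d} - {0}. Re (qform d A (u j))) = 0"
    using eq by simp
  hence "Re (qform d A (u j)) = 0"
    using nn *(2,3) by (subst (asm) sum_nonneg_eq_0_iff) auto
  thus "qform d A (u j) = 0"
    using nn by (simp add: complex_eq_iff)
qed

text \<open>For \<open>j \<noteq> 0\<close> the trace condition forces \<open>\<langle>u\<^sub>j \<otimes> e\<^sub>a, R (u\<^sub>j \<otimes> e\<^sub>a)\<rangle> = 0\<close>, so positivity
  puts \<open>u\<^sub>j \<otimes> e\<^sub>a\<close> into the kernel of \<open>R\<close>.\<close>
lemma product_of_full_slice: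
  assumes R: "pos_semidef (d * k) R" and u: "onb d u" and d: "d \<ge> 1"
    and full: "Re (qform d (ptrace k R) (u 0)) = Re (\<Sum>p<d * k. R p p)"
    and s: "s < d" and t: "t < d" and a: "a < k" and b: "b < k"
  shows "R (s * k + a) (t * k + b) = (u 0 s * cnj (u 0 t)) * slice d k R (u 0) a b"
proof -
  have ker: "(\<Sum>t<d. R p (t * k + b) * u j t) = 0"
    if p: "p < d * k" and j: "j < d" "j \<noteq> 0" and b: "b < k" for p j b
  proof -
    have sl: "pos_semidef k (slice d k R (u j))"
      by (rule pos_semidef_slice[OF R])
    have "(\<Sum>a<k. slice d k R (u j) a a) = 0"
      unfolding qform_ptrace[symmetric]
      by (rule qform_le_trace(2)[OF pos_semidef_ptrace[OF R] u d _ j])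
         (simp only: full trace_ptrace)
    hence "(\<Sum>a<k. Re (slice d k R (u j) a a)) = 0"
      unfolding Re_sum[symmetric] by simp
    hence "Re (slice d k R (u j) b b) = 0"
      using pos_semidef_diag_nonneg[OF sl] b by (subst (asm) sum_nonneg_eq_0_iff) auto
    hence "slice d k R (u j) b b = 0"
      using pos_semidef_diag_nonneg[OF sl b] by (simp add: complex_eq_iff)
    hence "qform k (slice d k R (u j)) (\<lambda>i. if i = b then 1 else 0) = 0"
      unfolding qform_unit[OF b] .
    hence "qform (d * k) R (\<lambda>p. u j (p div k) * (if p mod k = b then 1 else 0)) = 0"
      unfolding qform_slice .
    hence "(\<Sum>q<d * k. R p q * (u j (q div k) * (if q mod k = b then 1 else 0))) = 0"
      by (rule pos_semidef_kernel[OF R _ p])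
    moreover have "(\<Sum>q<d * k. R p q * (u j (q div k) * (if q mod k = b then 1 else 0))) =
      (\<Sum>t<d. \<Sum>a<k. (R p (t * k + a) * u j t) * (if a = b then 1 else 0))"
      unfolding sum_lessThan_mult by (intro sum.cong refl) auto
    ultimately show ?thesis
      by (simp only: sum_delta_mult[OF b])
  qed
  \<comment> \<open>By \<open>ker\<close>, only \<open>u 0\<close> survives when the first-factor
    column index is expanded along \<open>u\<close>.\<close>
  have right: "R p (t * k + b) = (\<Sum>t'<d. R p (t' * k + b) * u 0 t') * cnj (u 0 t)"
    if p: "p < d * k" and t: "t < d" and b: "b < k" for p t b
  proof -
    have "R p (t * k + b) = (\<Sum>j<d. (\<Sum>t'<d. R p (t' * k + b) * u j t') * cnj (u j t))"
      by (rule onb_expand_right[OF u t, of "\<lambda>t. R p (t * k + b)", symmetric])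
    also have "\<dots> = (\<Sum>j\<in>{0}. (\<Sum>t'<d. R p (t' * k + b) * u j t') * cnj (u j t))"
      using d ker[OF p _ _ b] by (intro sum.mono_neutral_right) auto
    finally show ?thesis by simp
  qed
  have herm: "R p q = cnj (R q p)" if "p < d * k" "q < d * k" for p q
    using pos_semidef_hermitian[OF R] that unfolding hermitian_def by blast
  \<comment> \<open>The same for the row index, by hermiticity.\<close>
  have left: "R (s * k + a) q = u 0 s * (\<Sum>s'<d. cnj (u 0 s') * R (s' * k + a) q)"
    if q: "q < d * k" for q
  proof -
    have "R (s * k + a) q = cnj ((\<Sum>s'<d. R q (s' * k + a) * u 0 s') * cnj (u 0 s))"
      using herm[OF mult_add_less[OF s a] q] right[OF q s a] by simp
    also have "\<dots> = u 0 s * (\<Sum>s'<d. cnj (u 0 s') * cnj (R q (s' * k + a)))"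
      by (simp add: mult_ac)
    also have "(\<Sum>s'<d. cnj (u 0 s') * cnj (R q (s' * k + a))) =
        (\<Sum>s'<d. cnj (u 0 s') * R (s' * k + a) q)"
      using herm[OF mult_add_less[OF _ a] q] by (intro sum.cong) auto
    finally show ?thesis .
  qed
  have "R (s * k + a) (t * k + b) = (\<Sum>t'<d. R (s * k + a) (t' * k + b) * u 0 t') * cnj (u 0 t)"
    by (rule right[OF mult_add_less[OF s a] t b])
  also have "(\<Sum>t'<d. R (s * k + a) (t' * k + b) * u 0 t') =
    (\<Sum>t'<d. u 0 s * (\<Sum>s'<d. cnj (u 0 s') * R (s' * k + a) (t' * k + b)) * u 0 t')"
    using left[OF mult_add_less[OF _ b]] by (intro sum.cong) auto
  also have "\<dots> = u 0 s * (\<Sum>t'<d. \<Sum>s'<d. cnj (u 0 s') * R (s' * k + a) (t' * k + b) * u 0 t')"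
    by (simp add: sum_distrib_left sum_distrib_right mult_ac)
  also have "(\<Sum>t'<d. \<Sum>s'<d. cnj (u 0 s') * R (s' * k + a) (t' * k + b) * u 0 t') = slice d k R (u 0) a b"
    unfolding slice_def by (rule sum.swap)
  finally show ?thesis by (simp only: mult_ac)
qed

lemma slice_of_product:
  assumes u: "(\<Sum>s<d. cnj (x s) * x s) = 1"
    and R: "\<And>s t. s < d \<Longrightarrow> t < d \<Longrightarrow> R (s * k + a) (t * k + b) = (x s * cnj (x t)) * c"
  shows "slice d k R x a b = c"
proof -
  have "slice d k R x a b = (\<Sum>s<d. \<Sum>t<d. c * ((cnj (x s) * x s) * (cnj (x t) * x t)))"
    unfolding slice_def using R by (intro sum.cong) auto
  also have "\<dots> = c * ((\<Sum>s<d. cnj (x s) * x s) * (\<Sum>t<d. cnj (x t) * x t))"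
    unfolding sum_product by (simp only: sum_distrib_left)
  finally show ?thesis using u by simp
qed

text \<open>The value of an input is the sum of the moduli of the \<open>\<gamma> i\<close> times
  the weight of its reduced state on \<open>u 0\<close>, which is at most one. A product input has
  weight one, so the supremum is a maximum.\<close>

lemma diamond_norm_rank_one:
  assumes d: "d \<ge> 1"
    and car: "\<And>i. i < n \<Longrightarrow> M i \<in> carrier_mat d d" "\<And>i. i < n \<Longrightarrow> N i \<in> carrier_mat d d"
    and u: "onb d u"
    and D: "\<And>i s t. i < n \<Longrightarrow> s < d \<Longrightarrow> t < d \<Longrightarrow> M i $$ (s, t) - N i $$ (s, t) = \<gamma> i * (u 0 s * cnj (u 0 t))"
  shows "diamond_norm d (\<lambda>\<sigma>. meas_channel n M \<sigma> - meas_channel n N \<sigma>) = (\<Sum>i<n. cmod (\<gamma> i))"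
proof -
  let ?G = "\<Sum>i<n. cmod (\<gamma> i)"
  let ?f = "\<lambda>\<rho>. trace_norm (tensor_id_apply d d (\<lambda>\<sigma>. meas_channel n M \<sigma> - meas_channel n N \<sigma>) \<rho>)"
  have val: "?f \<rho> = ?G * Re (qform d (ptrace d (\<lambda>a b. \<rho> $$ (a, b))) (u 0))" if "density (d * d) \<rho>" for \<rho>
    using density_pos_semidef(1)[OF that] by (intro trace_norm_rank_one[OF car D]) auto
  have le: "?f \<rho> \<le> ?G" if \<rho>: "density (d * d) \<rho>" for \<rho>
  proof -
    have "Re (qform d (ptrace d (\<lambda>a b. \<rho> $$ (a, b))) (u 0)) \<le> 1"
      using qform_le_trace(1)[OF pos_semidef_ptrace[OF density_pos_semidef(1)[OF \<rho>]] u d]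
      unfolding trace_ptrace density_pos_semidef(2)[OF \<rho>] by simp
    thus ?thesis
      unfolding val[OF \<rho>] by (intro mult_left_le) (auto intro: sum_nonneg)
  qed
  \<comment> \<open>The tensor product of \<open>u 0\<close> with the first basis vector of the
    reference system.\<close>
  define \<psi> where "\<psi> = vec (d * d) (\<lambda>p. u 0 (p div d) * (if p mod d = 0 then 1 else 0))"
  have u1: "(\<Sum>s<d. cnj (u 0 s) * u 0 s) = 1"
    using onbD[OF u, of 0 0] d by simp
  have \<psi>: "\<psi> $ (s * d + a) = u 0 s * (if a = 0 then 1 else 0)" if "s < d" "a < d" for s a
    using mult_add_less[OF that] that by (simp add: \<psi>_def)
  have "complex_of_real (\<Sum>p<d * d. (cmod (\<psi> $ p))\<^sup>2) =
      (\<Sum>s<d. \<Sum>a<d. (cnj (u 0 s) * u 0 s) * (if a = 0 then 1 else 0))"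
    unfolding of_real_sum complex_norm_square sum_lessThan_mult
    using \<psi> by (intro sum.cong refl) auto
  also have "\<dots> = 1"
    using d u1 by (simp only: sum_delta_mult)
  finally have unit: "unit_vector (d * d) \<psi>"
    by (simp only: of_real_eq_1_iff unit_vector_def) (simp add: \<psi>_def)
  define \<rho> where "\<rho> = proj \<psi>"
  have \<rho>: "density (d * d) \<rho>"
    unfolding \<rho>_def by (rule density_proj[OF unit])
  have "slice d d (\<lambda>a b. \<rho> $$ (a, b)) (u 0) a a = (if a = 0 then 1 else 0)" if a: "a < d" for a
    using a unit_vector_proj_dyad[OF unit mult_add_less mult_add_less]
    by (intro slice_of_product[OF u1]) (auto simp: \<rho>_def \<psi>)
  hence "qform d (ptrace d (\<lambda>a b. \<rho> $$ (a, b))) (u 0) = 1"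
    unfolding qform_ptrace using d by simp
  hence "?f \<rho> = ?G"
    using val[OF \<rho>] by simp
  thus ?thesis
    unfolding diamond_norm_def using \<rho> le by (intro cSup_eq_maximum) (auto intro!: image_eqI[of _ _ \<rho>])
qed

section \<open>The two directions of the characterisation\<close>

lemma povm_diff_hermitian:
  assumes "povm d n M" "povm d n N" "i < n"
  shows "hermitian d (\<lambda>s t. M i $$ (s, t) - N i $$ (s, t))"
proof -
  have "hermitian d (\<lambda>s t. M i $$ (s, t))" "hermitian d (\<lambda>s t. N i $$ (s, t))"
    using assms by (auto simp: povm_def psd_iff_pos_semidef intro!: pos_semidef_hermitian)
  thus ?thesis
    unfolding hermitian_def complex_cnj_diff by metis
qed

lemma exists_density:
  assumes "m \<ge> 1"
  shows "\<exists>\<rho>. density m \<rho>"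
proof -
  have "(\<Sum>i<m. (cmod (unit_vec m 0 $ i))\<^sup>2) = (\<Sum>i<m. if i = 0 then 1 else 0)"
    by (intro sum.cong) auto
  hence "unit_vector m (unit_vec m 0)"
    using assms by (simp add: unit_vector_def)
  thus ?thesis using density_proj by blast
qed

text \<open>The bound \<open>p\<close> on single inputs also bounds the diamond norm. For an MEWC
  pair that norm is the sum of all \<open>\<bar>l i j\<bar>\<close>, which supplies the premise of
  the rank-one conclusion.\<close>

lemma MEWC_imp_rank_one:
  assumes d: "d \<ge> 1" and M: "povm d n M" and N: "povm d n N"
    and mewc: "MEWC d (meas_channel n M) (meas_channel n N)"
  shows "\<exists>\<phi> \<gamma>. unit_vector d \<phi> \<and> (\<forall>i<n. M i - N i = \<gamma> i \<cdot>\<^sub>m proj \<phi>)"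
proof -
  have car: "M i \<in> carrier_mat d d" "N i \<in> carrier_mat d d" if "i < n" for i
    using M N that by (auto simp: povm_def psd_def)
  define D where "D i = (\<lambda>s t. M i $$ (s, t) - N i $$ (s, t))" for i
  have herm: "hermitian d (D i)" if "i < n" for i
    unfolding D_def by (rule povm_diff_hermitian[OF M N that])
  have "\<forall>i\<in>{..<n}. \<exists>u l. eigdec d (D i) u (\<lambda>j. of_real (l j))"
    using spectral_theorem[OF herm] by auto
  then obtain u where "\<forall>i\<in>{..<n}. \<exists>l. eigdec d (D i) (u i) (\<lambda>j. of_real (l j))"
    by metis
  then obtain l where dec: "\<And>i. i < n \<Longrightarrow> eigdec d (D i) (u i) (\<lambda>j. of_real (l i j))"
    by (metis lessThan_iff)
  obtain w p where
    bound: "\<And>A. pos_semidef d A \<Longrightarrow> (\<Sum>a<d. A a a) = 1 \<Longrightarrow>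
        (\<Sum>i<n. \<Sum>j<d. \<bar>l i j\<bar> * Re (qform d A (u i j))) \<le> p"
    and w: "(\<Sum>a<d. cnj (w a) * w a) = 1"
    and rank: "(\<Sum>i<n. \<Sum>j<d. \<bar>l i j\<bar>) \<le> p \<Longrightarrow>
        \<forall>i<n. \<exists>\<gamma>. \<forall>a<d. \<forall>b<d. D i a b = \<gamma> * (w a * cnj (w b))"
    using sum_abs_top_eigenvector[where D = D and l = l and u = u and n = n, OF d dec] by blast
  have le: "trace_norm (tensor_id_apply d d (\<lambda>\<sigma>. meas_channel n M \<sigma> - meas_channel n N \<sigma>) \<rho>) \<le> p"
    if \<rho>: "density (d * d) \<rho>" for \<rho>
  proof -
    let ?R = "\<lambda>a b. \<rho> $$ (a, b)"
    note R = density_pos_semidef[OF \<rho>]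
    note T = tensor_id_apply_meas_diff[where M = M and N = N and n = n and d = d and k = d and \<rho> = \<rho>, OF car, simplified, folded D_def]
    have "\<forall>i\<in>{..<n}. \<exists>v \<mu>. eigdec d (weighted_ptrace d d ?R (D i)) v \<mu>"
      using spectral_theorem[OF hermitian_weighted_ptrace[OF pos_semidef_hermitian[OF R(1)] herm]]
      by blast
    then obtain v where "\<forall>i\<in>{..<n}. \<exists>\<mu>. eigdec d (weighted_ptrace d d ?R (D i)) (v i) \<mu>"
      by metis
    then obtain \<mu> where v: "\<And>i. i < n \<Longrightarrow> eigdec d (weighted_ptrace d d ?R (D i)) (v i) (\<mu> i)"
      by (metis lessThan_iff)
    have "trace_norm (tensor_id_apply d d (\<lambda>\<sigma>. meas_channel n M \<sigma> - meas_channel n N \<sigma>) \<rho>) =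
      (\<Sum>i<n. \<Sum>j<d. cmod (\<mu> i j))"
      by (rule trace_norm_block_diag[OF T v])
    also have "\<dots> \<le> (\<Sum>i<n. \<Sum>j<d. \<bar>l i j\<bar> * Re (qform d (ptrace d ?R) (u i j)))"
      by (intro sum_mono weighted_ptrace_norm_bound[OF R(1) dec v]) auto
    also have "\<dots> \<le> p"
      using R by (intro bound pos_semidef_ptrace) (auto simp: trace_ptrace)
    finally show ?thesis .
  qed
  \<comment> \<open>The supremum of an empty set of reals is unspecified, so some input state must
    exist.\<close>
  have "{\<rho>. density (d * d) \<rho>} \<noteq> {}"
    using exists_density[of "d * d"] d by auto
  hence "diamond_norm d (\<lambda>\<sigma>. meas_channel n M \<sigma> - meas_channel n N \<sigma>) \<le> p"
    unfolding diamond_norm_def using le by (intro cSUP_least) auto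
  moreover have "diamond_norm d (\<lambda>\<sigma>. meas_channel n M \<sigma> - meas_channel n N \<sigma>) =
      (\<Sum>i<n. \<Sum>j<d. \<bar>l i j\<bar>)"
    using mewc me_norm_meas_diff[where M = M and N = N and n = n, OF d car dec[unfolded D_def]]
    by (simp add: MEWC_def)
  ultimately obtain \<gamma> where \<gamma>: "\<And>i a b. i < n \<Longrightarrow> a < d \<Longrightarrow> b < d \<Longrightarrow> D i a b = \<gamma> i * (w a * cnj (w b))"
    using rank by metis
  have "complex_of_real (\<Sum>i<d. (cmod (vec d w $ i))\<^sup>2) = 1"
    unfolding of_real_sum complex_norm_square w[symmetric] by (intro sum.cong) auto
  hence "unit_vector d (vec d w)"
    by (simp only: of_real_eq_1_iff unit_vector_def) simp
  moreover have "M i - N i = \<gamma> i \<cdot>\<^sub>m proj (vec d w)" if "i < n" for i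
    using car[OF that] \<gamma>[OF that] by (intro eq_matI) (auto simp: proj_def D_def)
  ultimately show ?thesis by blast
qed

text \<open>Each difference has eigenvalue \<open>\<gamma> i\<close> at \<open>u 0\<close> and zero
  elsewhere, so both sides of the defining equation are the sum of the moduli of the
  \<open>\<gamma> i\<close>.\<close>

lemma rank_one_imp_MEWC:
  assumes d: "d \<ge> 1"
    and car: "\<And>i. i < n \<Longrightarrow> M i \<in> carrier_mat d d" "\<And>i. i < n \<Longrightarrow> N i \<in> carrier_mat d d"
    and u: "onb d u"
    and D: "\<And>i s t. i < n \<Longrightarrow> s < d \<Longrightarrow> t < d \<Longrightarrow> M i $$ (s, t) - N i $$ (s, t) = \<gamma> i * (u 0 s * cnj (u 0 t))"
  shows "MEWC d (meas_channel n M) (meas_channel n N)"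
proof -
  have "eigdec d (\<lambda>s t. M i $$ (s, t) - N i $$ (s, t)) u (\<lambda>j. if j = 0 then \<gamma> i else 0)" if "i < n" for i
    unfolding eigdec_def using u d D[OF that]
    by (auto simp: if_distrib[of "\<lambda>x. x * _"] cong: if_cong)
  from me_norm_meas_diff[where M = M and N = N and n = n, OF d car this]
  have "of_nat d * me_norm d (\<lambda>\<sigma>. meas_channel n M \<sigma> - meas_channel n N \<sigma>) = (\<Sum>i<n. cmod (\<gamma> i))"
    using d by (simp add: if_distrib[of cmod] cong: if_cong)
  thus ?thesis
    using diamond_norm_rank_one[where M = M and N = N, OF d car u D] by (simp add: MEWC_def)
qed

section \<open>Optimal input states\<close>

lemma kron_proj_index:
  assumes "unit_vector d \<phi>" "\<tau> \<in> carrier_mat k k" "s < d" "t < d" "a < k" "b < k"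
  shows "kron (proj \<phi>) \<tau> $$ (s * k + a, t * k + b) = (\<phi> $ s * cnj (\<phi> $ t)) * \<tau> $$ (a, b)"
  using assms mult_add_less[of s d a k] mult_add_less[of t d b k]
  by (auto simp: kron_def proj_def unit_vector_def)

text \<open>A pure reduced state leaves no room for correlations with the second factor. The forward
  direction rests on \<open>product_of_full_slice\<close>, the backward one on computing the slice
  of a product.\<close>

lemma optimal_iff_product:
  assumes d: "d \<ge> 1" and \<phi>: "unit_vector d \<phi>" and u: "onb d u"
    and u\<phi>: "\<And>s t. s < d \<Longrightarrow> t < d \<Longrightarrow> u 0 s * cnj (u 0 t) = \<phi> $ s * cnj (\<phi> $ t)"
    and \<rho>: "density (d * k) \<rho>"
  shows "Re (qform d (ptrace k (\<lambda>a b. \<rho> $$ (a, b))) (u 0)) = 1 \<longleftrightarrow>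
    (\<exists>\<tau>. density k \<tau> \<and> \<rho> = kron (proj \<phi>) \<tau>)"
proof
  let ?R = "\<lambda>a b. \<rho> $$ (a, b)"
  note R = density_pos_semidef[OF \<rho>]
  assume full: "Re (qform d (ptrace k ?R) (u 0)) = 1"
  \<comment> \<open>The candidate for the reference state is the slice of \<open>\<rho>\<close> at
    \<open>u 0\<close>; it is positive, and its trace is the assumed weight one.\<close>
  define \<tau> where "\<tau> = mat k k (\<lambda>(a, b). slice d k ?R (u 0) a b)"
  have \<tau>: "\<tau> \<in> carrier_mat k k" by (simp add: \<tau>_def)
  have "pos_semidef k (\<lambda>a b. \<tau> $$ (a, b))"
    using pos_semidef_slice[OF R(1), of "u 0"]
    by (subst pos_semidef_cong[where B = "slice d k ?R (u 0)"]) (auto simp: \<tau>_def)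
  moreover have "qform d (ptrace k ?R) (u 0) = 1"
    using full pos_semidef_ptrace[OF R(1)] by (auto simp: complex_eq_iff pos_semidef_def)
  hence "mtrace \<tau> = 1"
    unfolding qform_ptrace by (simp add: mtrace_def \<tau>_def)
  ultimately have "density k \<tau>"
    using \<tau> by (simp add: density_def psd_iff_pos_semidef)
  moreover have "\<rho> = kron (proj \<phi>) \<tau>"
  proof (rule eq_matI)
    have dim: "dim_vec \<phi> = d" using \<phi> by (auto simp: unit_vector_def)
    show "dim_row \<rho> = dim_row (kron (proj \<phi>) \<tau>)" "dim_col \<rho> = dim_col (kron (proj \<phi>) \<tau>)"
      using R(3) \<tau> by (auto simp: kron_def proj_def dim)
    fix p q assume "p < dim_row (kron (proj \<phi>) \<tau>)" "q < dim_col (kron (proj \<phi>) \<tau>)"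
    hence pq: "p < d * k" "q < d * k"
      using \<tau> by (auto simp: kron_def proj_def dim)
    have k: "k > 0" using pq by (cases k) auto
    have st: "p div k < d" "q div k < d" using pq k by (auto simp: less_mult_imp_div_less)
    have ab: "p mod k < k" "q mod k < k" using k by auto
    have "Re (qform d (ptrace k ?R) (u 0)) = Re (\<Sum>p<d * k. ?R p p)"
      using full R(2) by simp
    from product_of_full_slice[OF R(1) u d this st ab]
    have "\<rho> $$ (p div k * k + p mod k, q div k * k + q mod k) =
        kron (proj \<phi>) \<tau> $$ (p div k * k + p mod k, q div k * k + q mod k)"
      unfolding kron_proj_index[OF \<phi> \<tau> st ab] u\<phi>[OF st] using ab by (simp add: \<tau>_def)
    thus "\<rho> $$ (p, q) = kron (proj \<phi>) \<tau> $$ (p, q)" by simp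
  qed
  ultimately show "\<exists>\<tau>. density k \<tau> \<and> \<rho> = kron (proj \<phi>) \<tau>" by blast
next
  assume "\<exists>\<tau>. density k \<tau> \<and> \<rho> = kron (proj \<phi>) \<tau>"
  then obtain \<tau> where \<tau>: "density k \<tau>" and eq: "\<rho> = kron (proj \<phi>) \<tau>" by blast
  note T = density_pos_semidef[OF \<tau>]
  have u1: "(\<Sum>s<d. cnj (u 0 s) * u 0 s) = 1"
    using onbD[OF u, of 0 0] d by simp
  have "slice d k (\<lambda>a b. \<rho> $$ (a, b)) (u 0) a a = \<tau> $$ (a, a)" if "a < k" for a
    using that by (intro slice_of_product[OF u1]) (simp only: eq kron_proj_index[OF \<phi> T(3)] u\<phi>)
  thus "Re (qform d (ptrace k (\<lambda>a b. \<rho> $$ (a, b))) (u 0)) = 1"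
    unfolding qform_ptrace using T(2) by simp
qed

text \<open>The reference dimension \<open>k\<close> of the inputs is arbitrary, while the diamond
  norm is taken with dimension \<open>d\<close>. In the second part some difference must be nonzero,
  since otherwise every input would be optimal.\<close>

theorem theorem3:
  fixes d n :: nat and M N :: "nat \<Rightarrow> complex mat"
  assumes "d \<ge> 1" and "n \<ge> 1"
    and "povm d n M" and "povm d n N"
  shows "(MEWC d (meas_channel n M) (meas_channel n N) \<longleftrightarrow>
           (\<exists>\<phi> \<gamma>. unit_vector d \<phi> \<and> (\<forall>i<n. M i - N i = \<gamma> i \<cdot>\<^sub>m proj \<phi>)))
    \<and> (\<forall>\<phi> \<gamma>. unit_vector d \<phi> \<and> (\<forall>i<n. M i - N i = \<gamma> i \<cdot>\<^sub>m proj \<phi>) \<and> (\<exists>i<n. M i \<noteq> N i) \<longrightarrow>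
         (\<forall>k \<rho>. k \<ge> 1 \<and> density (d * k) \<rho> \<longrightarrow>
           (trace_norm (tensor_id_apply d k (\<lambda>\<sigma>. meas_channel n M \<sigma> - meas_channel n N \<sigma>) \<rho>)
              = diamond_norm d (\<lambda>\<sigma>. meas_channel n M \<sigma> - meas_channel n N \<sigma>)
            \<longleftrightarrow> (\<exists>\<tau>. density k \<tau> \<and> \<rho> = kron (proj \<phi>) \<tau>))))"
proof (intro conjI allI impI)
  have car: "M i \<in> carrier_mat d d" "N i \<in> carrier_mat d d" if "i < n" for i
    using assms(3,4) that by (auto simp: povm_def psd_def)
  have entries: "M i $$ (s, t) - N i $$ (s, t) = \<gamma> i * (u 0 s * cnj (u 0 t))"
    if "unit_vector d \<phi>" "\<forall>i<n. M i - N i = \<gamma> i \<cdot>\<^sub>m proj \<phi>" "i < n" "s < d" "t < d"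
      "\<forall>a<d. \<forall>b<d. u 0 a * cnj (u 0 b) = \<phi> $ a * cnj (\<phi> $ b)" for \<phi> \<gamma> i s t and u :: "nat \<Rightarrow> nat \<Rightarrow> complex"
  proof -
    have "M i $$ (s, t) - N i $$ (s, t) = (M i - N i) $$ (s, t)"
      using that(3-5) car[OF that(3)] by simp
    also have "\<dots> = (\<gamma> i \<cdot>\<^sub>m proj \<phi>) $$ (s, t)"
      using that(2,3) by simp
    also have "\<dots> = \<gamma> i * proj \<phi> $$ (s, t)"
      using that(1,4,5) by (intro index_smult_mat) (auto simp: proj_def unit_vector_def)
    finally show ?thesis
      using that(4-6) unit_vector_proj_dyad[OF that(1,4,5)] by simp
  qed
  show "MEWC d (meas_channel n M) (meas_channel n N) \<longleftrightarrow>
    (\<exists>\<phi> \<gamma>. unit_vector d \<phi> \<and> (\<forall>i<n. M i - N i = \<gamma> i \<cdot>\<^sub>m proj \<phi>))"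
  proof
    assume "MEWC d (meas_channel n M) (meas_channel n N)"
    thus "\<exists>\<phi> \<gamma>. unit_vector d \<phi> \<and> (\<forall>i<n. M i - N i = \<gamma> i \<cdot>\<^sub>m proj \<phi>)"
      by (rule MEWC_imp_rank_one[OF assms(1,3,4)])
  next
    assume "\<exists>\<phi> \<gamma>. unit_vector d \<phi> \<and> (\<forall>i<n. M i - N i = \<gamma> i \<cdot>\<^sub>m proj \<phi>)"
    then obtain \<phi> \<gamma> where \<phi>: "unit_vector d \<phi>" and eq: "\<forall>i<n. M i - N i = \<gamma> i \<cdot>\<^sub>m proj \<phi>"
      by blast
    obtain u where u: "onb d u" "\<forall>a<d. \<forall>b<d. u 0 a * cnj (u 0 b) = \<phi> $ a * cnj (\<phi> $ b)"
      using unit_vector_onb[OF assms(1) \<phi>] by blast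
    have D: "M i $$ (s, t) - N i $$ (s, t) = \<gamma> i * (u 0 s * cnj (u 0 t))" if "i < n" "s < d" "t < d" for i s t
      by (rule entries[where u = u, OF \<phi> eq that u(2)])
    show "MEWC d (meas_channel n M) (meas_channel n N)"
      by (rule rank_one_imp_MEWC[OF assms(1) car u(1) D])
  qed
  fix \<phi> \<gamma> k \<rho>
  assume hyp: "unit_vector d \<phi> \<and> (\<forall>i<n. M i - N i = \<gamma> i \<cdot>\<^sub>m proj \<phi>) \<and> (\<exists>i<n. M i \<noteq> N i)"
    and k\<rho>: "k \<ge> 1 \<and> density (d * k) \<rho>"
  have \<phi>: "unit_vector d \<phi>" and eq: "\<forall>i<n. M i - N i = \<gamma> i \<cdot>\<^sub>m proj \<phi>" and \<rho>: "density (d * k) \<rho>"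
    using hyp k\<rho> by auto
  obtain u where u: "onb d u" "\<forall>a<d. \<forall>b<d. u 0 a * cnj (u 0 b) = \<phi> $ a * cnj (\<phi> $ b)"
    using unit_vector_onb[OF assms(1) \<phi>] by blast
  have D: "M i $$ (s, t) - N i $$ (s, t) = \<gamma> i * (u 0 s * cnj (u 0 t))" if "i < n" "s < d" "t < d" for i s t
    by (rule entries[where u = u, OF \<phi> eq that u(2)])
  let ?G = "\<Sum>i<n. cmod (\<gamma> i)"
  \<comment> \<open>This lets \<open>?G\<close> be cancelled from the optimality equation
    \<open>?G * ?q = ?G\<close>.\<close>
  have "?G \<noteq> 0"
  proof
    assume "?G = 0"
    hence \<gamma>: "\<gamma> i = 0" if "i < n" for i
      using that by (subst (asm) sum_nonneg_eq_0_iff) auto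
    have "M i = N i" if "i < n" for i
      using car[OF that] D[OF that] \<gamma>[OF that] by (intro eq_matI) auto
    thus False using hyp by auto
  qed
  let ?S = "\<lambda>\<sigma>. meas_channel n M \<sigma> - meas_channel n N \<sigma>"
  let ?q = "Re (qform d (ptrace k (\<lambda>a b. \<rho> $$ (a, b))) (u 0))"
  have "diamond_norm d ?S = ?G"
    by (rule diamond_norm_rank_one[OF assms(1) car u(1) D])
  moreover have "trace_norm (tensor_id_apply d k ?S \<rho>) = ?G * ?q"
    by (rule trace_norm_rank_one[OF car D density_pos_semidef(1)[OF \<rho>]])
  moreover have "?q = 1 \<longleftrightarrow> (\<exists>\<tau>. density k \<tau> \<and> \<rho> = kron (proj \<phi>) \<tau>)"
    using u(2) by (intro optimal_iff_product[OF assms(1) \<phi> u(1) _ \<rho>]) auto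
  ultimately show "trace_norm (tensor_id_apply d k ?S \<rho>) = diamond_norm d ?S
    \<longleftrightarrow> (\<exists>\<tau>. density k \<tau> \<and> \<rho> = kron (proj \<phi>) \<tau>)"
    using \<open>?G \<noteq> 0\<close> by simp
qed

end
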